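(* Let $(\mathcal A,\mathcal E)$ be an exact category. Let $\phi:\mathcal A\to\mathbb Z$ be a function on the objects of $\mathcal A$ such that $\phi$ is constant on isomorphism classes of objects in $\mathcal A$, $\phi$ is additive on finite biproducts, and $\phi$ is sub-additive on kernel-cokernel pairs in $\mathcal E$ (i.e., if $M\rightarrowtail N\twoheadrightarrow L$ is in $\mathcal E$, then $\phi(N)\le\phi(M)+\phi(L)$). Set $\mathcal E^{\phi}:=\{\text{kernel-cokernel pairs in }\mathcal E\text{ on which }\phi\text{ is additive}\}$, i.e. those $M\rightarrowtail N\twoheadrightarrow L$ in $\mathcal E$ with $\phi(N)=\phi(M)+\phi(L)$. Then $(\mathcal A,\mathcal E^{\phi})$ is an exact subcategory of $(\mathcal A,\mathcal E)$.
   Context: An exact category $(\mathcal A,\mathcal E)$ (Quillen) is an additive category $\mathcal A$ with a class $\mathcal E$ of kernel-cokernel pairs $M\xrightarrow{i}N\xrightarrow{p}L$ ($i$ is a kernel of $p$ and $p$ is a cokernel of $i$), closed under isomorphism, such that, calling the maps $i$ (resp. $p$) occurring in $\mathcal E$ admissible monics (resp. epics): identities are admissible monics and admissible epics; admissible monics (resp. epics) are closed under composition; the pushout of an admissible monic along any morphism exists and is an admissible monic; the pullback of an admissible epic along any morphism exists and is an admissible epic. An exact subcategory of $(\mathcal A,\mathcal E)$ is an exact category $(\mathcal A',\mathcal E')$ where $\mathcal A'$ is a full additive subcategory of $\mathcal A$ closed under isomorphism and $\mathcal E'\subseteq\mathcal E$. *)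

theory Defs
  imports "HOL-Algebra.FiniteProduct"
begin

text \<open>
  A (small) category with an addition and a zero on each hom-set. Every arrow has a unique domain
  and codomain; \<open>Comp C g f\<close> is the composite of \<open>f\<close> followed by \<open>g\<close>, meaningful only when
  \<open>Cod C f = Dom C g\<close>. Operations are unconstrained outside \<open>Obj\<close> and \<open>Arr\<close>.
\<close>

record ('o, 'm) add_cat =
  Obj :: "'o set"
  Arr :: "'m set"
  Dom :: "'m \<Rightarrow> 'o"
  Cod :: "'m \<Rightarrow> 'o"
  Id :: "'o \<Rightarrow> 'm"
  Comp :: "'m \<Rightarrow> 'm \<Rightarrow> 'm"
  Add :: "'m \<Rightarrow> 'm \<Rightarrow> 'm"
  Zero :: "'o \<Rightarrow> 'o \<Rightarrow> 'm"

definition Hom :: "('o, 'm, 'z) add_cat_scheme \<Rightarrow> 'o \<Rightarrow> 'o \<Rightarrow> 'm set" where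
  "Hom C A B = {f \<in> Arr C. Dom C f = A \<and> Cod C f = B}"

locale category =
  fixes C :: "('o, 'm, 'z) add_cat_scheme"
  assumes Dom_in_Obj: "f \<in> Arr C \<Longrightarrow> Dom C f \<in> Obj C"
    and Cod_in_Obj: "f \<in> Arr C \<Longrightarrow> Cod C f \<in> Obj C"
    and Id_in_Hom: "A \<in> Obj C \<Longrightarrow> Id C A \<in> Hom C A A"
    and Comp_in_Hom: "f \<in> Hom C A B \<Longrightarrow> g \<in> Hom C B D \<Longrightarrow> Comp C g f \<in> Hom C A D"
    and Comp_Id_left: "f \<in> Hom C A B \<Longrightarrow> Comp C (Id C B) f = f"
    and Comp_Id_right: "f \<in> Hom C A B \<Longrightarrow> Comp C f (Id C A) = f"
    and Comp_assoc: "f \<in> Hom C A B \<Longrightarrow> g \<in> Hom C B D \<Longrightarrow> h \<in> Hom C D E \<Longrightarrow>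
      Comp C h (Comp C g f) = Comp C (Comp C h g) f"

definition Hom_group :: "('o, 'm, 'z) add_cat_scheme \<Rightarrow> 'o \<Rightarrow> 'o \<Rightarrow> 'm monoid" where
  "Hom_group C A B = \<lparr>carrier = Hom C A B, mult = Add C, one = Zero C A B\<rparr>"

locale preadditive_category = category C for C :: "('o, 'm, 'z) add_cat_scheme" +
  assumes Hom_comm_group: "A \<in> Obj C \<Longrightarrow> B \<in> Obj C \<Longrightarrow> comm_group (Hom_group C A B)"
    and Comp_Add_right: "f \<in> Hom C A B \<Longrightarrow> f' \<in> Hom C A B \<Longrightarrow> g \<in> Hom C B D \<Longrightarrow>
      Comp C g (Add C f f') = Add C (Comp C g f) (Comp C g f')"
    and Comp_Add_left: "f \<in> Hom C A B \<Longrightarrow> g \<in> Hom C B D \<Longrightarrow> g' \<in> Hom C B D \<Longrightarrow>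
      Comp C (Add C g g') f = Add C (Comp C g f) (Comp C g' f)"

text \<open>
  \<open>B\<close> is a biproduct of \<open>A 0, \<dots>, A (n - 1)\<close> with injections \<open>inc k\<close> and projections \<open>pr k\<close>. The last
  clause is \<open>\<Sum>\<^sub>k inc k \<circ> pr k = id\<close>, since \<open>finprod\<close> of the hom group is an iterated \<open>Add\<close>. For
  \<open>n = 0\<close> it says that the identity of \<open>B\<close> is zero, i.e. that \<open>B\<close> is a zero object.
\<close>

definition is_biproduct ::
  "('o, 'm, 'z) add_cat_scheme \<Rightarrow> nat \<Rightarrow> (nat \<Rightarrow> 'o) \<Rightarrow> 'o \<Rightarrow> (nat \<Rightarrow> 'm) \<Rightarrow> (nat \<Rightarrow> 'm) \<Rightarrow> bool" where
  "is_biproduct C n A B inc pr \<longleftrightarrow>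
     B \<in> Obj C \<and>
     (\<forall>k<n. A k \<in> Obj C \<and> inc k \<in> Hom C (A k) B \<and> pr k \<in> Hom C B (A k)) \<and>
     (\<forall>j<n. \<forall>k<n. Comp C (pr j) (inc k) = (if j = k then Id C (A k) else Zero C (A k) (A j))) \<and>
     finprod (Hom_group C B B) (\<lambda>k. Comp C (inc k) (pr k)) {..<n} = Id C B"

locale additive_category = preadditive_category C for C :: "('o, 'm, 'z) add_cat_scheme" +
  assumes biproducts_exist:
    "(\<And>k. k < (n::nat) \<Longrightarrow> A k \<in> Obj C) \<Longrightarrow> \<exists>B inc pr. is_biproduct C n A B inc pr"

definition is_iso :: "('o, 'm, 'z) add_cat_scheme \<Rightarrow> 'm \<Rightarrow> bool" where
  "is_iso C f \<longleftrightarrow> f \<in> Arr C \<and>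
     (\<exists>g \<in> Hom C (Cod C f) (Dom C f).
        Comp C g f = Id C (Dom C f) \<and> Comp C f g = Id C (Cod C f))"

definition isomorphic :: "('o, 'm, 'z) add_cat_scheme \<Rightarrow> 'o \<Rightarrow> 'o \<Rightarrow> bool" where
  "isomorphic C A B \<longleftrightarrow> (\<exists>f \<in> Hom C A B. is_iso C f)"

definition is_kernel :: "('o, 'm, 'z) add_cat_scheme \<Rightarrow> 'm \<Rightarrow> 'm \<Rightarrow> bool" where
  "is_kernel C i p \<longleftrightarrow>
     i \<in> Arr C \<and> p \<in> Arr C \<and> Cod C i = Dom C p \<and>
     Comp C p i = Zero C (Dom C i) (Cod C p) \<and>
     (\<forall>X \<in> Obj C. \<forall>f \<in> Hom C X (Dom C p). Comp C p f = Zero C X (Cod C p) \<longrightarrow>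
        (\<exists>!g. g \<in> Hom C X (Dom C i) \<and> Comp C i g = f))"

definition is_cokernel :: "('o, 'm, 'z) add_cat_scheme \<Rightarrow> 'm \<Rightarrow> 'm \<Rightarrow> bool" where
  "is_cokernel C p i \<longleftrightarrow>
     i \<in> Arr C \<and> p \<in> Arr C \<and> Cod C i = Dom C p \<and>
     Comp C p i = Zero C (Dom C i) (Cod C p) \<and>
     (\<forall>X \<in> Obj C. \<forall>f \<in> Hom C (Cod C i) X. Comp C f i = Zero C (Dom C i) X \<longrightarrow>
        (\<exists>!g. g \<in> Hom C (Cod C p) X \<and> Comp C g p = f))"

definition kernel_cokernel_pair :: "('o, 'm, 'z) add_cat_scheme \<Rightarrow> 'm \<Rightarrow> 'm \<Rightarrow> bool" where
  "kernel_cokernel_pair C i p \<longleftrightarrow> is_kernel C i p \<and> is_cokernel C p i"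

definition pair_iso :: "('o, 'm, 'z) add_cat_scheme \<Rightarrow> 'm \<times> 'm \<Rightarrow> 'm \<times> 'm \<Rightarrow> bool" where
  "pair_iso C = (\<lambda>(i, p) (i', p').
     \<exists>a \<in> Hom C (Dom C i) (Dom C i').
     \<exists>b \<in> Hom C (Cod C i) (Cod C i').
     \<exists>c \<in> Hom C (Cod C p) (Cod C p').
       is_iso C a \<and> is_iso C b \<and> is_iso C c \<and>
       Comp C b i = Comp C i' a \<and> Comp C c p = Comp C p' b)"

text \<open>
  \<open>is_pushout C i f i' f'\<close>: the square with \<open>f' \<circ> i = i' \<circ> f\<close> is a pushout of the span \<open>i, f\<close>, so
  \<open>i'\<close> is the pushout of \<open>i\<close> along \<open>f\<close>. Dually, \<open>is_pullback C p f p' f'\<close>: the square with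
  \<open>p \<circ> f' = f \<circ> p'\<close> is a pullback of the cospan \<open>p, f\<close>, and \<open>p'\<close> is the pullback of \<open>p\<close> along \<open>f\<close>.
\<close>

definition is_pushout ::
  "('o, 'm, 'z) add_cat_scheme \<Rightarrow> 'm \<Rightarrow> 'm \<Rightarrow> 'm \<Rightarrow> 'm \<Rightarrow> bool" where
  "is_pushout C i f i' f' \<longleftrightarrow>
     i \<in> Arr C \<and> f \<in> Arr C \<and> i' \<in> Arr C \<and> f' \<in> Arr C \<and>
     Dom C i = Dom C f \<and> Dom C i' = Cod C f \<and> Dom C f' = Cod C i \<and> Cod C i' = Cod C f' \<and>
     Comp C f' i = Comp C i' f \<and>
     (\<forall>X \<in> Obj C. \<forall>u \<in> Hom C (Cod C i) X. \<forall>v \<in> Hom C (Cod C f) X.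
        Comp C u i = Comp C v f \<longrightarrow>
        (\<exists>!w. w \<in> Hom C (Cod C i') X \<and> Comp C w f' = u \<and> Comp C w i' = v))"

definition is_pullback ::
  "('o, 'm, 'z) add_cat_scheme \<Rightarrow> 'm \<Rightarrow> 'm \<Rightarrow> 'm \<Rightarrow> 'm \<Rightarrow> bool" where
  "is_pullback C p f p' f' \<longleftrightarrow>
     p \<in> Arr C \<and> f \<in> Arr C \<and> p' \<in> Arr C \<and> f' \<in> Arr C \<and>
     Cod C p = Cod C f \<and> Cod C p' = Dom C f \<and> Cod C f' = Dom C p \<and> Dom C p' = Dom C f' \<and>
     Comp C p f' = Comp C f p' \<and>
     (\<forall>X \<in> Obj C. \<forall>u \<in> Hom C X (Dom C p). \<forall>v \<in> Hom C X (Dom C f).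
        Comp C p u = Comp C f v \<longrightarrow>
        (\<exists>!w. w \<in> Hom C X (Dom C p') \<and> Comp C f' w = u \<and> Comp C p' w = v))"

definition admissible_monic :: "('m \<times> 'm) set \<Rightarrow> 'm \<Rightarrow> bool" where
  "admissible_monic E i \<longleftrightarrow> (\<exists>p. (i, p) \<in> E)"

definition admissible_epic :: "('m \<times> 'm) set \<Rightarrow> 'm \<Rightarrow> bool" where
  "admissible_epic E p \<longleftrightarrow> (\<exists>i. (i, p) \<in> E)"

locale exact_category = additive_category C
  for C :: "('o, 'm, 'z) add_cat_scheme" and E :: "('m \<times> 'm) set" +
  assumes pairs: "(i, p) \<in> E \<Longrightarrow> kernel_cokernel_pair C i p"
    and iso_closed: "(i, p) \<in> E \<Longrightarrow> kernel_cokernel_pair C i' p' \<Longrightarrow>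
      pair_iso C (i, p) (i', p') \<Longrightarrow> (i', p') \<in> E"
    and Id_monic: "A \<in> Obj C \<Longrightarrow> admissible_monic E (Id C A)"
    and Id_epic: "A \<in> Obj C \<Longrightarrow> admissible_epic E (Id C A)"
    and Comp_monic: "admissible_monic E i \<Longrightarrow> admissible_monic E j \<Longrightarrow> Cod C i = Dom C j \<Longrightarrow>
      admissible_monic E (Comp C j i)"
    and Comp_epic: "admissible_epic E p \<Longrightarrow> admissible_epic E q \<Longrightarrow> Cod C p = Dom C q \<Longrightarrow>
      admissible_epic E (Comp C q p)"
    and pushout_monic: "admissible_monic E i \<Longrightarrow> f \<in> Arr C \<Longrightarrow> Dom C f = Dom C i \<Longrightarrow>
      \<exists>i' f'. is_pushout C i f i' f' \<and> admissible_monic E i'"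
    and pullback_epic: "admissible_epic E p \<Longrightarrow> f \<in> Arr C \<Longrightarrow> Cod C f = Cod C p \<Longrightarrow>
      \<exists>p' f'. is_pullback C p f p' f' \<and> admissible_epic E p'"

text \<open>Full, with all structure (including the addition of arrows) inherited.\<close>

definition full_subcategory ::
  "('o, 'm, 'y) add_cat_scheme \<Rightarrow> ('o, 'm, 'z) add_cat_scheme \<Rightarrow> bool" where
  "full_subcategory C' C \<longleftrightarrow>
     Obj C' \<subseteq> Obj C \<and>
     Arr C' = {f \<in> Arr C. Dom C f \<in> Obj C' \<and> Cod C f \<in> Obj C'} \<and>
     (\<forall>f \<in> Arr C'. Dom C' f = Dom C f \<and> Cod C' f = Cod C f) \<and>
     (\<forall>A \<in> Obj C'. Id C' A = Id C A) \<and>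
     (\<forall>f \<in> Arr C'. \<forall>g \<in> Arr C'. Cod C f = Dom C g \<longrightarrow> Comp C' g f = Comp C g f) \<and>
     (\<forall>f \<in> Arr C'. \<forall>g \<in> Arr C'. Dom C f = Dom C g \<and> Cod C f = Cod C g \<longrightarrow>
        Add C' f g = Add C f g) \<and>
     (\<forall>A \<in> Obj C'. \<forall>B \<in> Obj C'. Zero C' A B = Zero C A B)"

text \<open>Additivity of \<open>C'\<close> is part of \<open>exact_category C' E'\<close>.\<close>

definition exact_subcategory ::
  "('o, 'm, 'y) add_cat_scheme \<Rightarrow> ('m \<times> 'm) set \<Rightarrow>
   ('o, 'm, 'z) add_cat_scheme \<Rightarrow> ('m \<times> 'm) set \<Rightarrow> bool" where
  "exact_subcategory C' E' C E \<longleftrightarrow>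
     exact_category C E \<and> exact_category C' E' \<and> full_subcategory C' C \<and>
     (\<forall>A \<in> Obj C'. \<forall>B \<in> Obj C. isomorphic C A B \<longrightarrow> B \<in> Obj C') \<and>
     E' \<subseteq> E"

definition additive_pairs ::
  "('o, 'm, 'z) add_cat_scheme \<Rightarrow> ('m \<times> 'm) set \<Rightarrow> ('o \<Rightarrow> int) \<Rightarrow> ('m \<times> 'm) set" where
  "additive_pairs C E \<phi> = {(i, p) \<in> E. \<phi> (Cod C i) = \<phi> (Dom C i) + \<phi> (Cod C p)}"

end

theory Submission
  imports Defs
begin

text \<open>
  Let \<open>P\<close> be the pushout of an admissible monic \<open>i: A \<rightarrow> B\<close> along \<open>f: A \<rightarrow> A'\<close>. The conflation
  \<open>A \<rightarrow> B \<oplus> A' \<rightarrow> P\<close> with maps \<open>(i, -f)\<close> and \<open>(f', i')\<close> gives \<open>\<phi> B + \<phi> A' \<le> \<phi> A + \<phi> P\<close>. If \<open>\<phi>\<close> is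
  additive on \<open>A \<rightarrow> B \<rightarrow> L\<close>, this reads \<open>\<phi> A' + \<phi> L \<le> \<phi> P\<close>, the converse of sub-additivity on
  \<open>A' \<rightarrow> P \<rightarrow> L\<close>. For composites of admissible monics, sub-additivity on the sequence of
  successive cokernels given by Noether's isomorphism suffices. The axioms for admissible epics
  follow by passing to the opposite category.
\<close>

section \<open>Kernels, cokernels and pushouts in a category with zero arrows\<close>

context category
begin

abbreviation comp (infixl "\<cdot>" 70) where "g \<cdot> f \<equiv> Comp C g f"

lemma Comp_simps:
  assumes "f \<in> Arr C" "g \<in> Arr C" "Cod C f = Dom C g"
  shows "g \<cdot> f \<in> Arr C" "Dom C (g \<cdot> f) = Dom C f" "Cod C (g \<cdot> f) = Cod C g"
  using Comp_in_Hom[of f "Dom C f" "Cod C f" g "Cod C g"] assms by (auto simp: Hom_def)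

lemma Id_simps:
  assumes "A \<in> Obj C"
  shows "Id C A \<in> Arr C" "Dom C (Id C A) = A" "Cod C (Id C A) = A"
  using Id_in_Hom[OF assms] by (auto simp: Hom_def)

lemma Comp_Id:
  "f \<in> Arr C \<Longrightarrow> Cod C f = A \<Longrightarrow> Id C A \<cdot> f = f"
  "f \<in> Arr C \<Longrightarrow> Dom C f = A \<Longrightarrow> f \<cdot> Id C A = f"
  using Comp_Id_left[of f] Comp_Id_right[of f] by (auto simp: Hom_def)

lemma Comp_assoc_Arr:
  "f \<in> Arr C \<Longrightarrow> g \<in> Arr C \<Longrightarrow> h \<in> Arr C \<Longrightarrow> Cod C f = Dom C g \<Longrightarrow> Cod C g = Dom C h \<Longrightarrow>
    h \<cdot> g \<cdot> f = h \<cdot> (g \<cdot> f)"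
  using Comp_assoc[of f _ _ g _ h] by (auto simp: Hom_def)

text \<open>Membership in a hom-set is unfolded into equations for domain and codomain, so that the
  simplifier settles the typing conditions of composites.\<close>

lemmas cat_simps = Hom_def Comp_simps Id_simps Comp_Id Dom_in_Obj Cod_in_Obj

lemma is_isoE:
  assumes "is_iso C f"
  obtains g where "g \<in> Hom C (Cod C f) (Dom C f)" "g \<cdot> f = Id C (Dom C f)" "f \<cdot> g = Id C (Cod C f)"
  using assms by (auto simp: is_iso_def)

lemma is_isoI:
  assumes "f \<in> Hom C A B" "g \<in> Hom C B A" "g \<cdot> f = Id C A" "f \<cdot> g = Id C B"
  shows "is_iso C f"
  using assms by (auto simp: is_iso_def Hom_def)

lemma isomorphicI:
  assumes "f \<in> Hom C A B" "g \<in> Hom C B A" "g \<cdot> f = Id C A" "f \<cdot> g = Id C B"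
  shows "isomorphic C A B"
  using assms is_isoI[OF assms] by (auto simp: isomorphic_def)

text \<open>Composites are normalised by nesting to the right, where a known value of
  \<open>h \<cdot> g\<close> is no longer visible as a subterm. Instances of this lemma restore such
  an equation as a rewrite rule.\<close>

lemma Comp_assoc_eq:
  "h \<cdot> g = k \<Longrightarrow> f \<in> Arr C \<Longrightarrow> g \<in> Arr C \<Longrightarrow> h \<in> Arr C \<Longrightarrow> Cod C f = Dom C g \<Longrightarrow>
    Cod C g = Dom C h \<Longrightarrow> h \<cdot> (g \<cdot> f) = k \<cdot> f"
  using Comp_assoc_Arr by metis

text \<open>The unique existence in the universal property is split into existence of a
  factorisation and left cancellation of \<open>i\<close>, which are proved separately in all
  applications.\<close>

lemma is_kernelI:
  assumes "i \<in> Hom C A B" "p \<in> Hom C B P" "p \<cdot> i = Zero C A P"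
    and "\<And>X f. X \<in> Obj C \<Longrightarrow> f \<in> Hom C X B \<Longrightarrow> p \<cdot> f = Zero C X P \<Longrightarrow> \<exists>g\<in>Hom C X A. i \<cdot> g = f"
    and "\<And>X g h. g \<in> Hom C X A \<Longrightarrow> h \<in> Hom C X A \<Longrightarrow> i \<cdot> g = i \<cdot> h \<Longrightarrow> g = h"
  shows "is_kernel C i p"
proof -
  have "\<exists>!g. g \<in> Hom C X A \<and> i \<cdot> g = f"
    if "X \<in> Obj C" "f \<in> Hom C X B" "p \<cdot> f = Zero C X P" for X f
    using assms(4)[OF that] assms(5) by metis
  moreover have eqs: "i \<in> Arr C" "p \<in> Arr C" "Dom C i = A" "Cod C i = B" "Dom C p = B" "Cod C p = P"
    using assms by (auto simp: Hom_def)
  ultimately show ?thesis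
    using assms(3) unfolding is_kernel_def eqs by blast
qed

lemma is_cokernelI:
  assumes "i \<in> Hom C A B" "p \<in> Hom C B P" "p \<cdot> i = Zero C A P"
    and "\<And>X f. X \<in> Obj C \<Longrightarrow> f \<in> Hom C B X \<Longrightarrow> f \<cdot> i = Zero C A X \<Longrightarrow> \<exists>g\<in>Hom C P X. g \<cdot> p = f"
    and "\<And>X g h. g \<in> Hom C P X \<Longrightarrow> h \<in> Hom C P X \<Longrightarrow> g \<cdot> p = h \<cdot> p \<Longrightarrow> g = h"
  shows "is_cokernel C p i"
proof -
  have "\<exists>!g. g \<in> Hom C P X \<and> g \<cdot> p = f"
    if "X \<in> Obj C" "f \<in> Hom C B X" "f \<cdot> i = Zero C A X" for X f
    using assms(4)[OF that] assms(5) by metis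
  moreover have eqs: "i \<in> Arr C" "p \<in> Arr C" "Dom C i = A" "Cod C i = B" "Dom C p = B" "Cod C p = P"
    using assms by (auto simp: Hom_def)
  ultimately show ?thesis
    using assms(3) unfolding is_cokernel_def eqs by blast
qed

lemma is_cokernel_factor:
  assumes "is_cokernel C p i" "f \<in> Hom C (Dom C p) X" "f \<cdot> i = Zero C (Dom C i) X"
  obtains g where "g \<in> Hom C (Cod C p) X" "g \<cdot> p = f"
proof -
  have "X \<in> Obj C" using assms(2) by (auto simp: Hom_def Cod_in_Obj)
  then show ?thesis using assms that unfolding is_cokernel_def by metis
qed

lemma is_kernel_factor:
  assumes "is_kernel C i p" "f \<in> Hom C X (Dom C p)" "p \<cdot> f = Zero C X (Cod C p)"
  obtains g where "g \<in> Hom C X (Dom C i)" "i \<cdot> g = f"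
proof -
  have "X \<in> Obj C" using assms(2) by (auto simp: Hom_def Dom_in_Obj)
  then show ?thesis using assms that unfolding is_kernel_def by metis
qed

lemma is_pushoutI:
  assumes "i \<in> Hom C A B" "f \<in> Hom C A A'" "i' \<in> Hom C A' P" "f' \<in> Hom C B P" "f' \<cdot> i = i' \<cdot> f"
    and "\<And>X u v. X \<in> Obj C \<Longrightarrow> u \<in> Hom C B X \<Longrightarrow> v \<in> Hom C A' X \<Longrightarrow> u \<cdot> i = v \<cdot> f \<Longrightarrow>
      \<exists>w\<in>Hom C P X. w \<cdot> f' = u \<and> w \<cdot> i' = v"
    and "\<And>X g h. g \<in> Hom C P X \<Longrightarrow> h \<in> Hom C P X \<Longrightarrow> g \<cdot> f' = h \<cdot> f' \<Longrightarrow> g \<cdot> i' = h \<cdot> i' \<Longrightarrow> g = h"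
  shows "is_pushout C i f i' f'"
proof -
  have "\<exists>!w. w \<in> Hom C P X \<and> w \<cdot> f' = u \<and> w \<cdot> i' = v"
    if "X \<in> Obj C" "u \<in> Hom C B X" "v \<in> Hom C A' X" "u \<cdot> i = v \<cdot> f" for X u v
    using assms(6)[OF that] assms(7) by metis
  moreover have eqs: "i \<in> Arr C" "f \<in> Arr C" "i' \<in> Arr C" "f' \<in> Arr C" "Dom C i = A" "Cod C i = B"
    "Dom C f = A" "Cod C f = A'" "Dom C i' = A'" "Cod C i' = P" "Dom C f' = B" "Cod C f' = P"
    using assms by (auto simp: Hom_def)
  ultimately show ?thesis
    using assms(5) unfolding is_pushout_def eqs by blast
qed

lemma is_pushout_factor:
  assumes "is_pushout C i f i' f'" "u \<in> Hom C (Cod C i) X" "v \<in> Hom C (Cod C f) X" "u \<cdot> i = v \<cdot> f"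
  obtains w where "w \<in> Hom C (Cod C i') X" "w \<cdot> f' = u" "w \<cdot> i' = v"
proof -
  have "X \<in> Obj C" using assms(2) by (auto simp: Hom_def Cod_in_Obj)
  then have "\<exists>!w. w \<in> Hom C (Cod C i') X \<and> w \<cdot> f' = u \<and> w \<cdot> i' = v"
    using assms unfolding is_pushout_def by blast
  then show ?thesis using that by blast
qed

text \<open>Both \<open>g\<close> and \<open>h\<close> are induced by the cocone
  \<open>h \<cdot> f'\<close>, \<open>h \<cdot> i'\<close>. In other words, the two arrows into a
  pushout are jointly epic.\<close>

lemma is_pushout_cancel:
  assumes "is_pushout C i f i' f'" "g \<in> Hom C (Cod C i') X" "h \<in> Hom C (Cod C i') X"
    and "g \<cdot> f' = h \<cdot> f'" "g \<cdot> i' = h \<cdot> i'"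
  shows "g = h"
proof -
  have ar: "i \<in> Arr C" "f \<in> Arr C" "i' \<in> Arr C" "f' \<in> Arr C" "Dom C i = Dom C f" "Dom C i' = Cod C f"
    "Dom C f' = Cod C i" "Cod C i' = Cod C f'" "f' \<cdot> i = i' \<cdot> f"
    using assms(1) by (auto simp: is_pushout_def)
  then have "X \<in> Obj C" "h \<cdot> f' \<in> Hom C (Cod C i) X" "h \<cdot> i' \<in> Hom C (Cod C f) X"
    "h \<cdot> f' \<cdot> i = h \<cdot> i' \<cdot> f"
    using assms(3) by (auto simp: cat_simps Comp_assoc_Arr)
  then have "\<exists>!w. w \<in> Hom C (Cod C i') X \<and> w \<cdot> f' = h \<cdot> f' \<and> w \<cdot> i' = h \<cdot> i'"
    using assms(1) unfolding is_pushout_def by blast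
  then show ?thesis using assms by blast
qed

text \<open>Each of the two squares induces an arrow to the other, and joint cancellation makes them
  inverse. Compatibility with \<open>i'\<close> is recorded because it carries admissibility from
  one pushout to another.\<close>

lemma is_pushout_unique:
  assumes P: "is_pushout C i f i' f'" and Q: "is_pushout C i f i'' f''"
  obtains g h where "g \<in> Hom C (Cod C i') (Cod C i'')" "h \<in> Hom C (Cod C i'') (Cod C i')"
    "h \<cdot> g = Id C (Cod C i')" "g \<cdot> h = Id C (Cod C i'')" "g \<cdot> i' = i''"
proof -
  have ar: "i \<in> Arr C" "f \<in> Arr C" "i' \<in> Arr C" "f' \<in> Arr C" "Dom C i = Dom C f" "Dom C i' = Cod C f"
    "Dom C f' = Cod C i" "Cod C i' = Cod C f'" "f' \<cdot> i = i' \<cdot> f"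
    "i'' \<in> Arr C" "f'' \<in> Arr C" "Dom C i'' = Cod C f"
    "Dom C f'' = Cod C i" "Cod C i'' = Cod C f''" "f'' \<cdot> i = i'' \<cdot> f"
    using P Q by (auto simp: is_pushout_def)
  obtain g where g: "g \<in> Hom C (Cod C i') (Cod C i'')" "g \<cdot> f' = f''" "g \<cdot> i' = i''"
    using is_pushout_factor[OF P, of f'' _ i''] ar by (auto simp: cat_simps)
  obtain h where h: "h \<in> Hom C (Cod C i'') (Cod C i')" "h \<cdot> f'' = f'" "h \<cdot> i'' = i'"
    using is_pushout_factor[OF Q, of f' _ i'] ar by (auto simp: cat_simps)
  have "h \<cdot> g = Id C (Cod C i')"
    by (rule is_pushout_cancel[OF P]) (use g h ar in \<open>auto simp: cat_simps Comp_assoc_Arr\<close>)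
  moreover have "g \<cdot> h = Id C (Cod C i'')"
    by (rule is_pushout_cancel[OF Q]) (use g h ar in \<open>auto simp: cat_simps Comp_assoc_Arr\<close>)
  ultimately show ?thesis using that g h by blast
qed

end

section \<open>Arithmetic of arrows and cokernels in a preadditive category\<close>

context preadditive_category
begin

abbreviation add (infixl "\<oplus>" 65) where "f \<oplus> g \<equiv> Add C f g"

lemma Zero_simps:
  assumes "A \<in> Obj C" "B \<in> Obj C"
  shows "Zero C A B \<in> Arr C" "Dom C (Zero C A B) = A" "Cod C (Zero C A B) = B"
proof -
  interpret comm_group "Hom_group C A B" using Hom_comm_group[OF assms] .
  show "Zero C A B \<in> Arr C" "Dom C (Zero C A B) = A" "Cod C (Zero C A B) = B"
    using one_closed by (auto simp: Hom_group_def Hom_def)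
qed

lemma comm_group_of_Hom:
  assumes "f \<in> Hom C A B"
  shows "comm_group (Hom_group C A B)"
  using assms Hom_comm_group[of A B] Dom_in_Obj[of f] Cod_in_Obj[of f] by (auto simp: Hom_def)

lemma carrier_Hom_group: "carrier (Hom_group C A B) = Hom C A B"
  and mult_Hom_group: "mult (Hom_group C A B) = Add C"
  and one_Hom_group: "one (Hom_group C A B) = Zero C A B"
  by (simp_all add: Hom_group_def)

lemmas Hom_group_sel = carrier_Hom_group mult_Hom_group one_Hom_group

lemma Add_in_Hom: "f \<in> Hom C A B \<Longrightarrow> g \<in> Hom C A B \<Longrightarrow> f \<oplus> g \<in> Hom C A B"
  using comm_groupE(1)[OF comm_group_of_Hom] unfolding Hom_group_sel by blast

lemma Add_assoc:
  "f \<in> Hom C A B \<Longrightarrow> g \<in> Hom C A B \<Longrightarrow> h \<in> Hom C A B \<Longrightarrow> f \<oplus> g \<oplus> h = f \<oplus> (g \<oplus> h)"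
  using comm_groupE(3)[OF comm_group_of_Hom] unfolding Hom_group_sel by blast

lemma Add_commute: "f \<in> Hom C A B \<Longrightarrow> g \<in> Hom C A B \<Longrightarrow> f \<oplus> g = g \<oplus> f"
  using comm_groupE(4)[OF comm_group_of_Hom] unfolding Hom_group_sel by blast

lemma Zero_Add: "f \<in> Hom C A B \<Longrightarrow> Zero C A B \<oplus> f = f"
  using comm_groupE(5)[OF comm_group_of_Hom] unfolding Hom_group_sel by blast

lemma Add_right_cancel:
  assumes "f \<in> Hom C A B" "g \<in> Hom C A B" "h \<in> Hom C A B" "f \<oplus> h = g \<oplus> h"
  shows "f = g"
proof -
  interpret comm_group "Hom_group C A B" by (rule comm_group_of_Hom[OF assms(1)])
  show ?thesis using right_cancel[of h f g] assms unfolding Hom_group_sel by blast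
qed

lemma Add_simps:
  assumes "f \<in> Arr C" "g \<in> Arr C" "Dom C f = Dom C g" "Cod C f = Cod C g"
  shows "f \<oplus> g \<in> Arr C" "Dom C (f \<oplus> g) = Dom C g" "Cod C (f \<oplus> g) = Cod C g"
  using Add_in_Hom[of f "Dom C f" "Cod C f" g] assms by (auto simp: Hom_def)

lemma Add_Zero:
  "f \<in> Arr C \<Longrightarrow> Dom C f = A \<Longrightarrow> Cod C f = B \<Longrightarrow> f \<oplus> Zero C A B = f"
  "f \<in> Arr C \<Longrightarrow> Dom C f = A \<Longrightarrow> Cod C f = B \<Longrightarrow> Zero C A B \<oplus> f = f"
  using Zero_Add[of f A B] Add_commute[of f A B "Zero C A B"]
  by (auto simp: Hom_def Zero_simps Dom_in_Obj Cod_in_Obj)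

lemma ex_negative:
  assumes "f \<in> Hom C A B"
  obtains n where "n \<in> Hom C A B" "f \<oplus> n = Zero C A B"
proof -
  interpret comm_group "Hom_group C A B" by (rule comm_group_of_Hom[OF assms])
  show ?thesis using r_inv_ex[of f] assms that unfolding Hom_group_sel by blast
qed

lemma Comp_Add_distrib:
  "f \<in> Arr C \<Longrightarrow> f' \<in> Arr C \<Longrightarrow> g \<in> Arr C \<Longrightarrow> Dom C f = Dom C f' \<Longrightarrow> Cod C f = Cod C f' \<Longrightarrow>
    Cod C f' = Dom C g \<Longrightarrow> g \<cdot> (f \<oplus> f') = g \<cdot> f \<oplus> g \<cdot> f'"
  "f \<in> Arr C \<Longrightarrow> g \<in> Arr C \<Longrightarrow> g' \<in> Arr C \<Longrightarrow> Dom C g = Dom C g' \<Longrightarrow> Cod C g = Cod C g' \<Longrightarrow>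
    Cod C f = Dom C g' \<Longrightarrow> (g \<oplus> g') \<cdot> f = g \<cdot> f \<oplus> g' \<cdot> f"
  using Comp_Add_right[of f _ _ f' g] Comp_Add_left[of f _ _ g _ g'] by (auto simp: Hom_def)

lemma Add_idem_Zero:
  assumes "f \<in> Arr C" "f \<oplus> f = f"
  shows "f = Zero C (Dom C f) (Cod C f)"
  using Add_right_cancel[of f "Dom C f" "Cod C f" "Zero C (Dom C f) (Cod C f)" f] assms
  by (auto simp: Zero_simps Add_Zero cat_simps)

text \<open>By distributivity a composite with a zero arrow equals its own double, and cancellation
  in the hom group makes it zero.\<close>

lemma Comp_Zero:
  assumes "f \<in> Arr C" "A \<in> Obj C"
  shows "B = Dom C f \<Longrightarrow> f \<cdot> Zero C A B = Zero C A (Cod C f)"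
    "B = Cod C f \<Longrightarrow> Zero C B A \<cdot> f = Zero C (Dom C f) A"
proof -
  have 1: "f \<cdot> Zero C A (Dom C f) \<oplus> f \<cdot> Zero C A (Dom C f) = f \<cdot> Zero C A (Dom C f)"
    using assms Comp_Add_distrib(1)[of "Zero C A (Dom C f)" "Zero C A (Dom C f)" f]
    by (simp add: Zero_simps Add_Zero cat_simps)
  show "B = Dom C f \<Longrightarrow> f \<cdot> Zero C A B = Zero C A (Cod C f)"
    using Add_idem_Zero[OF _ 1] assms by (simp add: Zero_simps cat_simps)
  have 2: "Zero C (Cod C f) A \<cdot> f \<oplus> Zero C (Cod C f) A \<cdot> f = Zero C (Cod C f) A \<cdot> f"
    using assms Comp_Add_distrib(2)[of f "Zero C (Cod C f) A" "Zero C (Cod C f) A"]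
    by (simp add: Zero_simps Add_Zero cat_simps)
  show "B = Cod C f \<Longrightarrow> Zero C B A \<cdot> f = Zero C (Dom C f) A"
    using Add_idem_Zero[OF _ 2] assms by (simp add: Zero_simps cat_simps)
qed

lemmas preadd_simps = cat_simps Zero_simps Add_simps Add_Zero Comp_Zero

text \<open>The arrow \<open>h \<cdot> p\<close> kills \<open>i\<close>, and both \<open>g\<close>
  and \<open>h\<close> are its factorisation through \<open>p\<close>.\<close>

lemma is_cokernel_cancel:
  assumes "is_cokernel C p i" "g \<in> Hom C (Cod C p) X" "h \<in> Hom C (Cod C p) X" "g \<cdot> p = h \<cdot> p"
  shows "g = h"
proof -
  have ar: "i \<in> Arr C" "p \<in> Arr C" "Cod C i = Dom C p" "p \<cdot> i = Zero C (Dom C i) (Cod C p)"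
    using assms(1) by (auto simp: is_cokernel_def)
  then have "X \<in> Obj C" "h \<cdot> p \<in> Hom C (Cod C i) X" "h \<cdot> p \<cdot> i = Zero C (Dom C i) X"
    using assms(3) by (auto simp: preadd_simps Comp_assoc_Arr)
  then have "\<exists>!w. w \<in> Hom C (Cod C p) X \<and> w \<cdot> p = h \<cdot> p"
    using assms(1) unfolding is_cokernel_def by blast
  then show ?thesis using assms by blast
qed

lemma is_kernel_cancel:
  assumes "is_kernel C i p" "g \<in> Hom C X (Dom C i)" "h \<in> Hom C X (Dom C i)" "i \<cdot> g = i \<cdot> h"
  shows "g = h"
proof -
  have ar: "i \<in> Arr C" "p \<in> Arr C" "Cod C i = Dom C p" "p \<cdot> i = Zero C (Dom C i) (Cod C p)"
    using assms(1) by (auto simp: is_kernel_def)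
  then have "X \<in> Obj C" "i \<cdot> h \<in> Hom C X (Dom C p)" "p \<cdot> (i \<cdot> h) = Zero C X (Cod C p)"
    using assms(3) by (auto simp: preadd_simps Comp_assoc_eq)
  then have "\<exists>!w. w \<in> Hom C X (Dom C i) \<and> i \<cdot> w = i \<cdot> h"
    using assms(1) unfolding is_kernel_def by blast
  then show ?thesis using assms by blast
qed

text \<open>Each cokernel factors through the other. An isomorphism-invariant function may therefore
  be evaluated on any cokernel of \<open>i\<close>.\<close>

lemma is_cokernel_isomorphic:
  assumes p: "is_cokernel C p i" and q: "is_cokernel C q i"
  shows "isomorphic C (Cod C p) (Cod C q)"
proof -
  have ar: "i \<in> Arr C" "p \<in> Arr C" "q \<in> Arr C" "Cod C i = Dom C p" "Cod C i = Dom C q"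
    "p \<cdot> i = Zero C (Dom C i) (Cod C p)" "q \<cdot> i = Zero C (Dom C i) (Cod C q)"
    using p q by (auto simp: is_cokernel_def)
  obtain g where g: "g \<in> Hom C (Cod C p) (Cod C q)" "g \<cdot> p = q"
    using is_cokernel_factor[OF p, of q] ar by (auto simp: cat_simps)
  obtain h where h: "h \<in> Hom C (Cod C q) (Cod C p)" "h \<cdot> q = p"
    using is_cokernel_factor[OF q, of p] ar by (auto simp: cat_simps)
  have "h \<cdot> g = Id C (Cod C p)"
    by (rule is_cokernel_cancel[OF p]) (use g h ar in \<open>auto simp: cat_simps Comp_assoc_Arr\<close>)
  moreover have "g \<cdot> h = Id C (Cod C q)"
    by (rule is_cokernel_cancel[OF q]) (use g h ar in \<open>auto simp: cat_simps Comp_assoc_Arr\<close>)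
  ultimately show ?thesis by (rule isomorphicI[OF g(1) h(1)])
qed

text \<open>Factorisation problems for the new pair are moved to the old one with \<open>b\<close>
  or \<open>b'\<close>, and the solutions serve unchanged because the outer objects stay the same.
  The closure axiom for isomorphic pairs asks for this property of its target.\<close>

lemma kernel_cokernel_pair_iso_middle:
  assumes kc: "kernel_cokernel_pair C i p" and b: "b \<in> Hom C (Cod C i) B" "b' \<in> Hom C B (Cod C i)"
    and inv: "b' \<cdot> b = Id C (Cod C i)" "b \<cdot> b' = Id C B"
  shows "kernel_cokernel_pair C (b \<cdot> i) (p \<cdot> b')"
proof -
  have k: "is_kernel C i p" and c: "is_cokernel C p i"
    using kc by (auto simp: kernel_cokernel_pair_def)
  have ar: "i \<in> Arr C" "p \<in> Arr C" "Cod C i = Dom C p" "p \<cdot> i = Zero C (Dom C i) (Cod C p)"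
    using k by (auto simp: is_kernel_def)
  have zero: "p \<cdot> b' \<cdot> (b \<cdot> i) = Zero C (Dom C i) (Cod C p)"
    using ar b inv by (auto simp: preadd_simps Comp_assoc_Arr Comp_assoc_eq[OF inv(1)])
  have "is_kernel C (b \<cdot> i) (p \<cdot> b')"
  proof (rule is_kernelI[OF _ _ zero])
    fix X f assume "X \<in> Obj C" and f: "f \<in> Hom C X B" "p \<cdot> b' \<cdot> f = Zero C X (Cod C p)"
    obtain g where g: "g \<in> Hom C X (Dom C i)" "i \<cdot> g = b' \<cdot> f"
      by (rule is_kernel_factor[OF k, of "b' \<cdot> f"]) (use f b ar in \<open>auto simp: preadd_simps Comp_assoc_Arr\<close>)
    have "b \<cdot> i \<cdot> g = f"
      using g f b ar by (simp add: preadd_simps Comp_assoc_Arr Comp_assoc_eq[OF inv(2)])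
    then show "\<exists>g\<in>Hom C X (Dom C i). b \<cdot> i \<cdot> g = f" using g by blast
  next
    fix X g h assume gh: "g \<in> Hom C X (Dom C i)" "h \<in> Hom C X (Dom C i)" "b \<cdot> i \<cdot> g = b \<cdot> i \<cdot> h"
    have "i \<cdot> x = b' \<cdot> (b \<cdot> i \<cdot> x)" if "x \<in> Hom C X (Dom C i)" for x
      using that b ar by (simp add: preadd_simps Comp_assoc_Arr Comp_assoc_eq[OF inv(1)])
    then have "i \<cdot> g = i \<cdot> h" using gh by simp
    then show "g = h" using is_kernel_cancel[OF k gh(1,2)] by blast
  qed (use b ar in \<open>auto simp: preadd_simps\<close>)
  moreover have "is_cokernel C (p \<cdot> b') (b \<cdot> i)"
  proof (rule is_cokernelI[OF _ _ zero])
    fix X f assume "X \<in> Obj C" and f: "f \<in> Hom C B X" "f \<cdot> (b \<cdot> i) = Zero C (Dom C i) X"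
    obtain g where g: "g \<in> Hom C (Cod C p) X" "g \<cdot> p = f \<cdot> b"
      by (rule is_cokernel_factor[OF c, of "f \<cdot> b"]) (use f b ar in \<open>auto simp: preadd_simps Comp_assoc_Arr\<close>)
    have "g \<cdot> (p \<cdot> b') = g \<cdot> p \<cdot> b'"
      using g(1) f b ar by (simp add: preadd_simps Comp_assoc_Arr)
    also have "\<dots> = f"
      using g f b ar inv(2) by (simp add: preadd_simps Comp_assoc_Arr)
    finally show "\<exists>g\<in>Hom C (Cod C p) X. g \<cdot> (p \<cdot> b') = f" using g by blast
  next
    fix X g h assume gh: "g \<in> Hom C (Cod C p) X" "h \<in> Hom C (Cod C p) X" "g \<cdot> (p \<cdot> b') = h \<cdot> (p \<cdot> b')"
    have "x \<cdot> p = x \<cdot> (p \<cdot> b') \<cdot> b" if "x \<in> Hom C (Cod C p) X" for x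
      using that b ar inv(1) by (simp add: preadd_simps Comp_assoc_Arr)
    then have "g \<cdot> p = h \<cdot> p" using gh by simp
    then show "g = h" using is_cokernel_cancel[OF c gh(1,2)] by blast
  qed (use b ar in \<open>auto simp: preadd_simps\<close>)
  ultimately show ?thesis by (simp add: kernel_cokernel_pair_def)
qed

end

section \<open>Binary and empty biproducts\<close>

definition biproduct2 ::
  "('o, 'm, 'z) add_cat_scheme \<Rightarrow> 'o \<Rightarrow> 'o \<Rightarrow> 'o \<Rightarrow> 'm \<Rightarrow> 'm \<Rightarrow> 'm \<Rightarrow> 'm \<Rightarrow> bool" where
  "biproduct2 C A B S i1 i2 p1 p2 \<longleftrightarrow>
     A \<in> Obj C \<and> B \<in> Obj C \<and> S \<in> Obj C \<and>
     i1 \<in> Hom C A S \<and> i2 \<in> Hom C B S \<and> p1 \<in> Hom C S A \<and> p2 \<in> Hom C S B \<and>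
     Comp C p1 i1 = Id C A \<and> Comp C p2 i2 = Id C B \<and>
     Comp C p2 i1 = Zero C A B \<and> Comp C p1 i2 = Zero C B A \<and>
     Add C (Comp C i1 p1) (Comp C i2 p2) = Id C S"

context preadditive_category
begin

text \<open>Over two indices the product in the hom group is a single \<open>Add\<close>. All later
  computations can then use named injections and projections in place of indexed families.\<close>

lemma is_biproduct_2_iff:
  "is_biproduct C 2 A S inc pr \<longleftrightarrow>
    biproduct2 C (A 0) (A 1) S (inc 0) (inc 1) (pr 0) (pr 1)"
proof -
  have "finprod (Hom_group C S S) (\<lambda>k. inc k \<cdot> pr k) {..<2} = inc 0 \<cdot> pr 0 \<oplus> inc 1 \<cdot> pr 1"
    if S: "S \<in> Obj C" and h: "\<And>k. k < 2 \<Longrightarrow> A k \<in> Obj C \<and> inc k \<in> Hom C (A k) S \<and> pr k \<in> Hom C S (A k)"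
  proof -
    interpret comm_group "Hom_group C S S" using Hom_comm_group[OF S S] .
    have m: "inc k \<cdot> pr k \<in> carrier (Hom_group C S S)" if "k < 2" for k
      using h[OF that] by (auto simp: cat_simps Hom_group_def)
    \<comment> \<open>The index set is written as an insertion so that the recursion rule for
      \<open>finprod\<close> applies.\<close>
    have "finprod (Hom_group C S S) (\<lambda>k. inc k \<cdot> pr k) {..<2} =
        finprod (Hom_group C S S) (\<lambda>k. inc k \<cdot> pr k) (insert 0 {1})"
      by (rule arg_cong) auto
    also have "\<dots> = mult (Hom_group C S S) (inc 0 \<cdot> pr 0) (inc 1 \<cdot> pr 1)"
      using m[of 0] m[of 1] by (simp add: Pi_def del: One_nat_def)
    also have "\<dots> = inc 0 \<cdot> pr 0 \<oplus> inc 1 \<cdot> pr 1"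
      by (simp add: Hom_group_def)
    finally show ?thesis .
  qed
  note sum = this
  have all2: "(\<forall>k<2. P k) \<longleftrightarrow> P 0 \<and> P (1::nat)" for P
    by (auto simp: less_2_cases_iff)
  show ?thesis
  proof (cases "S \<in> Obj C \<and> (\<forall>k<2. A k \<in> Obj C \<and> inc k \<in> Hom C (A k) S \<and> pr k \<in> Hom C S (A k))")
    case True
    then have "finprod (Hom_group C S S) (\<lambda>k. inc k \<cdot> pr k) {..<2} = inc 0 \<cdot> pr 0 \<oplus> inc 1 \<cdot> pr 1"
      by (intro sum) blast+
    with True show ?thesis unfolding is_biproduct_def biproduct2_def all2 by simp blast
  next
    case False
    then show ?thesis unfolding is_biproduct_def biproduct2_def all2 by blast
  qed
qed

text \<open>The empty sum in the hom group is the zero arrow, so an empty biproduct is exactly a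
  zero object.\<close>

lemma is_biproduct_0_iff: "is_biproduct C 0 A S inc pr \<longleftrightarrow> S \<in> Obj C \<and> Id C S = Zero C S S"
proof -
  have "finprod (Hom_group C S S) (\<lambda>k. inc k \<cdot> pr k) {} = Zero C S S" if "S \<in> Obj C"
  proof -
    interpret comm_group "Hom_group C S S" using Hom_comm_group[OF that that] .
    show ?thesis by (simp only: finprod_empty one_Hom_group)
  qed
  then show ?thesis by (auto simp: is_biproduct_def)
qed

text \<open>These are the four relations between injections and projections, in the form that
  matches composites nested to the right.\<close>

lemma biproduct2_Comp:
  assumes "biproduct2 C A B S i1 i2 p1 p2" "x \<in> Arr C"
  shows "Cod C x = A \<Longrightarrow> p1 \<cdot> (i1 \<cdot> x) = x" "Cod C x = B \<Longrightarrow> p2 \<cdot> (i2 \<cdot> x) = x"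
    "Cod C x = A \<Longrightarrow> p2 \<cdot> (i1 \<cdot> x) = Zero C (Dom C x) B"
    "Cod C x = B \<Longrightarrow> p1 \<cdot> (i2 \<cdot> x) = Zero C (Dom C x) A"
proof -
  note b = assms(1)[unfolded biproduct2_def]
  have eqs: "p1 \<cdot> i1 = Id C A" "p2 \<cdot> i2 = Id C B" "p2 \<cdot> i1 = Zero C A B" "p1 \<cdot> i2 = Zero C B A"
    using b by auto
  show "Cod C x = A \<Longrightarrow> p1 \<cdot> (i1 \<cdot> x) = x"
    using b assms(2) by (auto simp: preadd_simps Comp_assoc_eq[OF eqs(1)])
  show "Cod C x = B \<Longrightarrow> p2 \<cdot> (i2 \<cdot> x) = x"
    using b assms(2) by (auto simp: preadd_simps Comp_assoc_eq[OF eqs(2)])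
  show "Cod C x = A \<Longrightarrow> p2 \<cdot> (i1 \<cdot> x) = Zero C (Dom C x) B"
    using b assms(2) by (auto simp: preadd_simps Comp_assoc_eq[OF eqs(3)])
  show "Cod C x = B \<Longrightarrow> p1 \<cdot> (i2 \<cdot> x) = Zero C (Dom C x) A"
    using b assms(2) by (auto simp: preadd_simps Comp_assoc_eq[OF eqs(4)])
qed

text \<open>Compose \<open>w\<close> with the decomposition of the identity of \<open>S\<close>. It
  follows that an arrow out of \<open>S\<close> is determined by its composites with the
  injections.\<close>

lemma biproduct2_decomp:
  assumes "biproduct2 C A B S i1 i2 p1 p2" "w \<in> Hom C S X"
  shows "w = w \<cdot> i1 \<cdot> p1 \<oplus> w \<cdot> i2 \<cdot> p2"
proof -
  have b: "i1 \<in> Hom C A S" "i2 \<in> Hom C B S" "p1 \<in> Hom C S A" "p2 \<in> Hom C S B"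
    "i1 \<cdot> p1 \<oplus> i2 \<cdot> p2 = Id C S"
    using assms(1) by (auto simp: biproduct2_def)
  then have "w = w \<cdot> (i1 \<cdot> p1 \<oplus> i2 \<cdot> p2)"
    using assms(2) by (simp add: cat_simps)
  also have "\<dots> = w \<cdot> i1 \<cdot> p1 \<oplus> w \<cdot> i2 \<cdot> p2"
    using b(1-4) assms(2) by (auto simp: cat_simps Comp_Add_distrib Comp_assoc_Arr)
  finally show ?thesis .
qed

section \<open>Pushouts, shears and cokernels expressed through biproducts\<close>

lemma biproduct2_is_pushout:
  assumes b: "biproduct2 C A B S i1 i2 p1 p2" and Z: "Z \<in> Obj C" "Id C Z = Zero C Z Z"
  shows "is_pushout C (Zero C Z B) (Zero C Z A) i1 i2"
proof -
  note b' = b[unfolded biproduct2_def]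
  show ?thesis
  proof (rule is_pushoutI[where A = Z and B = B and A' = A and P = S])
    fix X u v assume uv: "X \<in> Obj C" "u \<in> Hom C B X" "v \<in> Hom C A X"
    let ?w = "v \<cdot> p1 \<oplus> u \<cdot> p2"
    have "?w \<in> Hom C S X" "?w \<cdot> i2 = u" "?w \<cdot> i1 = v"
      using uv b' by (auto simp: preadd_simps Comp_Add_distrib Comp_assoc_Arr biproduct2_Comp[OF b])
    then show "\<exists>w\<in>Hom C S X. w \<cdot> i2 = u \<and> w \<cdot> i1 = v" by blast
  next
    fix X g h assume "g \<in> Hom C S X" "h \<in> Hom C S X" "g \<cdot> i2 = h \<cdot> i2" "g \<cdot> i1 = h \<cdot> i1"
    then show "g = h" using biproduct2_decomp[OF b, of g X] biproduct2_decomp[OF b, of h X] by simp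
  qed (use b' Z in \<open>auto simp: preadd_simps\<close>)
qed

text \<open>The arrow named here is the sum of \<open>i\<close> and the identity of
  \<open>A'\<close>. A cocone \<open>u\<close>, \<open>v\<close> satisfies
  \<open>u \<cdot> i = v \<cdot> i1\<close>, so only \<open>v \<cdot> i2\<close> remains free, and
  the pair \<open>u\<close>, \<open>v \<cdot> i2\<close> is an arrow out of
  \<open>T\<close>.\<close>

lemma is_pushout_sum_Id:
  assumes S: "biproduct2 C A A' S i1 i2 p1 p2" and T: "biproduct2 C B A' T j1 j2 q1 q2"
    and i: "i \<in> Hom C A B"
  shows "is_pushout C i i1 (j1 \<cdot> i \<cdot> p1 \<oplus> j2 \<cdot> p2) j1"
proof -
  note b' = S[unfolded biproduct2_def] T[unfolded biproduct2_def] i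
  let ?s = "j1 \<cdot> i \<cdot> p1 \<oplus> j2 \<cdot> p2"
  show ?thesis
  proof (rule is_pushoutI[where A = A and B = B and A' = S and P = T])
    show "j1 \<cdot> i = ?s \<cdot> i1"
      using b' by (auto simp: preadd_simps Comp_Add_distrib Comp_assoc_Arr biproduct2_Comp[OF S] biproduct2_Comp[OF T])
  next
    fix X u v assume uv: "X \<in> Obj C" "u \<in> Hom C B X" "v \<in> Hom C S X" and eq: "u \<cdot> i = v \<cdot> i1"
    let ?w = "u \<cdot> q1 \<oplus> v \<cdot> i2 \<cdot> q2"
    have 1: "?w \<in> Hom C T X" "?w \<cdot> j1 = u" "?w \<cdot> j2 = v \<cdot> i2"
      using uv b' by (auto simp: preadd_simps Comp_Add_distrib Comp_assoc_Arr biproduct2_Comp[OF S] biproduct2_Comp[OF T])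
    have "?w \<cdot> ?s = ?w \<cdot> j1 \<cdot> i \<cdot> p1 \<oplus> ?w \<cdot> j2 \<cdot> p2"
      using 1(1) b' by (auto simp: preadd_simps Comp_Add_distrib(1) Comp_assoc_Arr biproduct2_Comp[OF S] biproduct2_Comp[OF T])
    also have "\<dots> = v"
      using biproduct2_decomp[OF S uv(3)] eq 1(2,3) by simp
    finally show "\<exists>w\<in>Hom C T X. w \<cdot> j1 = u \<and> w \<cdot> ?s = v" using 1 by blast
  next
    fix X g h assume gh: "g \<in> Hom C T X" "h \<in> Hom C T X" "g \<cdot> j1 = h \<cdot> j1" "g \<cdot> ?s = h \<cdot> ?s"
    have "w \<cdot> j2 = w \<cdot> ?s \<cdot> i2" if "w \<in> Hom C T X" for w
      using that b' by (auto simp: preadd_simps Comp_Add_distrib Comp_assoc_Arr biproduct2_Comp[OF S] biproduct2_Comp[OF T])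
    then have "g \<cdot> j2 = h \<cdot> j2" using gh by metis
    then show "g = h"
      using gh biproduct2_decomp[OF T, of g X] biproduct2_decomp[OF T, of h X] by simp
  qed (use b' in \<open>auto simp: preadd_simps\<close>)
qed

text \<open>The shear \<open>Id C S \<oplus> i2 \<cdot> n \<cdot> p1\<close> is an automorphism of
  \<open>S\<close>, and its inverse has \<open>f\<close> in place of \<open>n\<close> because
  \<open>f\<close> is the negative of \<open>n\<close>. The biproduct is transported along it. The
  purpose is to exhibit the graph of \<open>n\<close> as a biproduct injection.\<close>

lemma biproduct2_twist:
  assumes S: "biproduct2 C A B S i1 i2 p1 p2" and f: "f \<in> Hom C A B"
    and n: "n \<in> Hom C A B" "f \<oplus> n = Zero C A B"
  shows "biproduct2 C A B S (i1 \<oplus> i2 \<cdot> n) i2 p1 (p2 \<oplus> f \<cdot> p1)"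
proof -
  note b = S[unfolded biproduct2_def] f n(1)
  have n': "n \<oplus> f = Zero C A B"
    using n f Add_commute[of n A B f] by (auto simp: Hom_def)
  have "(p2 \<oplus> f \<cdot> p1) \<cdot> (i1 \<oplus> i2 \<cdot> n) = Zero C A B"
    using b n(2) by (auto simp: preadd_simps Comp_Add_distrib Comp_assoc_Arr biproduct2_Comp[OF S])
  moreover have "(i1 \<oplus> i2 \<cdot> n) \<cdot> p1 \<oplus> i2 \<cdot> (p2 \<oplus> f \<cdot> p1) = Id C S"
  proof -
    \<comment> \<open>The sum is rearranged until the terms containing \<open>n\<close> and
      \<open>f\<close> are adjacent and cancel.\<close>
    have "(i1 \<oplus> i2 \<cdot> n) \<cdot> p1 \<oplus> i2 \<cdot> (p2 \<oplus> f \<cdot> p1)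
        = i1 \<cdot> p1 \<oplus> i2 \<cdot> (n \<cdot> p1) \<oplus> (i2 \<cdot> (f \<cdot> p1) \<oplus> i2 \<cdot> p2)"
      using b Add_commute[of "i2 \<cdot> p2" S S "i2 \<cdot> (f \<cdot> p1)"]
      by (auto simp: preadd_simps Comp_Add_distrib Comp_assoc_Arr)
    also have "\<dots> = i1 \<cdot> p1 \<oplus> (i2 \<cdot> (n \<cdot> p1) \<oplus> i2 \<cdot> (f \<cdot> p1) \<oplus> i2 \<cdot> p2)"
      using b by (simp add: preadd_simps Add_assoc[of _ S S])
    also have "i2 \<cdot> (n \<cdot> p1) \<oplus> i2 \<cdot> (f \<cdot> p1) = i2 \<cdot> ((n \<oplus> f) \<cdot> p1)"
      using b by (auto simp: preadd_simps Comp_Add_distrib)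
    also have "\<dots> = Zero C S S" using b n' by (auto simp: preadd_simps)
    finally show ?thesis using b by (auto simp: preadd_simps)
  qed
  ultimately show ?thesis
    using b unfolding biproduct2_def
    by (auto simp: preadd_simps Comp_Add_distrib Comp_assoc_Arr biproduct2_Comp[OF S])
qed

text \<open>Here \<open>n\<close> is the negative of \<open>f\<close>. An arrow \<open>w\<close> out
  of the biproduct kills the second map precisely when
  \<open>w \<cdot> j1 \<cdot> i = w \<cdot> j2 \<cdot> f\<close>, that is, when its components form
  a cocone over the span.\<close>

lemma pushout_is_cokernel_sum:
  assumes P: "is_pushout C i f i' f'"
    and T: "biproduct2 C (Cod C i) (Cod C f) T j1 j2 q1 q2"
    and n: "n \<in> Hom C (Dom C f) (Cod C f)" "f \<oplus> n = Zero C (Dom C f) (Cod C f)"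
  shows "is_cokernel C (f' \<cdot> q1 \<oplus> i' \<cdot> q2) (j1 \<cdot> i \<oplus> j2 \<cdot> n)"
proof -
  have ar: "i \<in> Arr C" "f \<in> Arr C" "i' \<in> Arr C" "f' \<in> Arr C" "Dom C i = Dom C f" "Dom C i' = Cod C f"
    "Dom C f' = Cod C i" "Cod C i' = Cod C f'" "f' \<cdot> i = i' \<cdot> f"
    using P by (auto simp: is_pushout_def)
  note b = T[unfolded biproduct2_def] n(1) ar(1-8)
  let ?q = "f' \<cdot> q1 \<oplus> i' \<cdot> q2"
  let ?m = "j1 \<cdot> i \<oplus> j2 \<cdot> n"
  have qj: "?q \<cdot> j1 = f'" "?q \<cdot> j2 = i'"
    using b by (auto simp: preadd_simps Comp_Add_distrib Comp_assoc_Arr)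
  have q: "?q \<in> Hom C T (Cod C i')" and m: "?m \<in> Hom C (Dom C f) T"
    using b by (auto simp: preadd_simps)
  have wm: "w \<cdot> ?m = w \<cdot> j1 \<cdot> i \<oplus> w \<cdot> j2 \<cdot> n" if "w \<in> Hom C T X" for w X
    using that b by (auto simp: preadd_simps Comp_Add_distrib(1) Comp_assoc_Arr)
  have fn: "x \<cdot> f \<oplus> x \<cdot> n = Zero C (Dom C f) (Cod C x)" if "x \<in> Arr C" "Dom C x = Cod C f" for x
    using that b n Comp_Add_distrib(1)[of f n x] by (auto simp: preadd_simps)
  show ?thesis
  proof (rule is_cokernelI[OF m q])
    show "?q \<cdot> ?m = Zero C (Dom C f) (Cod C i')"
      using wm[OF q] qj ar fn by auto
  next
    fix X w assume w: "X \<in> Obj C" "w \<in> Hom C T X" "w \<cdot> ?m = Zero C (Dom C f) X"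
    \<comment> \<open>Both sides are zero, the left by the assumption on \<open>w\<close> and the
      right because \<open>f \<oplus> n\<close> is zero. Cancelling the common summand leaves the
      cocone equation.\<close>
    have "w \<cdot> j1 \<cdot> i \<oplus> w \<cdot> j2 \<cdot> n = w \<cdot> j2 \<cdot> f \<oplus> w \<cdot> j2 \<cdot> n"
      using w(3) wm[OF w(2)] fn[of "w \<cdot> j2"] w(2) b by (auto simp: preadd_simps)
    then have "w \<cdot> j1 \<cdot> i = w \<cdot> j2 \<cdot> f"
      using w(2) b Add_right_cancel[of "w \<cdot> j1 \<cdot> i" "Dom C f" X "w \<cdot> j2 \<cdot> f" "w \<cdot> j2 \<cdot> n"]
      by (auto simp: preadd_simps)
    then obtain g where g: "g \<in> Hom C (Cod C i') X" "g \<cdot> f' = w \<cdot> j1" "g \<cdot> i' = w \<cdot> j2"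
      by (rule is_pushout_factor[OF P, rotated 2]) (use w(2) b in \<open>auto simp: preadd_simps\<close>)
    have "g \<cdot> ?q = g \<cdot> f' \<cdot> q1 \<oplus> g \<cdot> i' \<cdot> q2"
      using g(1) b by (auto simp: preadd_simps Comp_Add_distrib(1) Comp_assoc_Arr)
    then have "g \<cdot> ?q = w" using g biproduct2_decomp[OF T w(2)] by simp
    then show "\<exists>g\<in>Hom C (Cod C i') X. g \<cdot> ?q = w" using g(1) by blast
  next
    fix X g h assume gh: "g \<in> Hom C (Cod C i') X" "h \<in> Hom C (Cod C i') X" "g \<cdot> ?q = h \<cdot> ?q"
    have "x \<cdot> f' = x \<cdot> ?q \<cdot> j1" "x \<cdot> i' = x \<cdot> ?q \<cdot> j2" if "x \<in> Hom C (Cod C i') X" for x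
      using that qj b by (auto simp: preadd_simps Comp_assoc_Arr)
    then show "g = h" using is_pushout_cancel[OF P gh(1,2)] gh by metis
  qed
qed

section \<open>Cokernels of pushouts and of composites\<close>

lemma pushout_cokernel:
  assumes P: "is_pushout C i f i' f'" and c: "is_cokernel C p i"
  obtains r where "is_cokernel C r i'" "Cod C r = Cod C p"
proof -
  have ar: "i \<in> Arr C" "f \<in> Arr C" "i' \<in> Arr C" "f' \<in> Arr C" "Dom C i = Dom C f" "Dom C i' = Cod C f"
    "Dom C f' = Cod C i" "Cod C i' = Cod C f'" "f' \<cdot> i = i' \<cdot> f"
    "p \<in> Arr C" "Dom C p = Cod C i" "p \<cdot> i = Zero C (Dom C i) (Cod C p)"
    using P c by (auto simp: is_pushout_def is_cokernel_def)
  \<comment> \<open>The arrow \<open>r\<close> is induced by \<open>p\<close> and the zero arrow,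
    which form a cocone since \<open>p \<cdot> i\<close> is zero.\<close>
  obtain r where r: "r \<in> Hom C (Cod C i') (Cod C p)" "r \<cdot> f' = p" "r \<cdot> i' = Zero C (Cod C f) (Cod C p)"
    by (rule is_pushout_factor[OF P, of p "Cod C p" "Zero C (Cod C f) (Cod C p)"])
      (use ar in \<open>auto simp: preadd_simps\<close>)
  have "is_cokernel C r i'"
  proof (rule is_cokernelI[OF _ r(1)])
    fix X w assume w: "X \<in> Obj C" "w \<in> Hom C (Cod C i') X" "w \<cdot> i' = Zero C (Dom C i') X"
    have "w \<cdot> f' \<cdot> i = w \<cdot> i' \<cdot> f"
      using w(2) ar by (auto simp: preadd_simps Comp_assoc_Arr)
    then obtain g where g: "g \<in> Hom C (Cod C p) X" "g \<cdot> p = w \<cdot> f'"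
      using is_cokernel_factor[OF c, of "w \<cdot> f'" X] w ar by (auto simp: preadd_simps)
    \<comment> \<open>The arrows \<open>g \<cdot> r\<close> and \<open>w\<close> agree after both
      maps into the pushout, hence they are equal.\<close>
    have "g \<cdot> r \<cdot> f' = w \<cdot> f'" "g \<cdot> r \<cdot> i' = w \<cdot> i'" "g \<cdot> r \<in> Hom C (Cod C i') X"
      using g r w ar by (auto simp: preadd_simps Comp_assoc_Arr)
    then show "\<exists>g\<in>Hom C (Cod C p) X. g \<cdot> r = w"
      using is_pushout_cancel[OF P _ w(2)] g(1) by blast
  next
    fix X g h assume gh: "g \<in> Hom C (Cod C p) X" "h \<in> Hom C (Cod C p) X" "g \<cdot> r = h \<cdot> r"
    have "x \<cdot> p = x \<cdot> r \<cdot> f'" if "x \<in> Hom C (Cod C p) X" for x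
      using that r(1,2) ar by (auto simp: cat_simps Comp_assoc_Arr)
    then show "g = h" using is_cokernel_cancel[OF c gh(1,2)] gh by metis
  qed (use r(3) ar in \<open>auto simp: Hom_def\<close>)
  then show ?thesis using that r(1) by (auto simp: Hom_def)
qed

text \<open>If \<open>w\<close> kills \<open>j \<cdot> i\<close>, then \<open>w \<cdot> j\<close>
  kills \<open>i\<close> and factors through \<open>p\<close>. The factor and \<open>w\<close> form
  a cocone on \<open>j\<close> and \<open>p\<close>, which induces the factorisation of
  \<open>w\<close> through \<open>p'\<close>.\<close>

lemma pushout_along_cokernel:
  assumes c: "is_cokernel C p i" and P: "is_pushout C j p j' p'"
  shows "is_cokernel C p' (j \<cdot> i)"
proof -
  have ar: "j \<in> Arr C" "p \<in> Arr C" "j' \<in> Arr C" "p' \<in> Arr C" "Dom C j = Dom C p" "Dom C j' = Cod C p"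
    "Dom C p' = Cod C j" "Cod C j' = Cod C p'" "p' \<cdot> j = j' \<cdot> p"
    "i \<in> Arr C" "Dom C p = Cod C i" "p \<cdot> i = Zero C (Dom C i) (Cod C p)"
    using P c by (auto simp: is_pushout_def is_cokernel_def)
  show ?thesis
  proof (rule is_cokernelI[where A = "Dom C i" and B = "Cod C j" and P = "Cod C p'"])
    show "p' \<cdot> (j \<cdot> i) = Zero C (Dom C i) (Cod C p')"
      using ar by (auto simp: preadd_simps Comp_assoc_Arr Comp_assoc_eq[OF ar(9)])
  next
    fix X w assume w: "X \<in> Obj C" "w \<in> Hom C (Cod C j) X" "w \<cdot> (j \<cdot> i) = Zero C (Dom C i) X"
    obtain g where g: "g \<in> Hom C (Cod C p) X" "g \<cdot> p = w \<cdot> j"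
      using is_cokernel_factor[OF c, of "w \<cdot> j" X] w ar by (auto simp: preadd_simps Comp_assoc_Arr)
    obtain h where h: "h \<in> Hom C (Cod C j') X" "h \<cdot> p' = w" "h \<cdot> j' = g"
      using is_pushout_factor[OF P w(2) g(1)] g by auto
    then show "\<exists>g\<in>Hom C (Cod C p') X. g \<cdot> p' = w" using ar by auto
  next
    fix X g h assume gh: "g \<in> Hom C (Cod C p') X" "h \<in> Hom C (Cod C p') X" "g \<cdot> p' = h \<cdot> p'"
    have "x \<cdot> j' \<cdot> p = x \<cdot> p' \<cdot> j" if "x \<in> Hom C (Cod C p') X" for x
      using that ar by (auto simp: preadd_simps Comp_assoc_Arr)
    \<comment> \<open>Agreement on \<open>p'\<close> gives agreement on \<open>j' \<cdot> p\<close>.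
      Since \<open>p\<close> is epic, the arrows agree on \<open>j'\<close> too, and the two maps
      into the pushout are jointly epic.\<close>
    then have "g \<cdot> j' \<cdot> p = h \<cdot> j' \<cdot> p" using gh by metis
    then have "g \<cdot> j' = h \<cdot> j'"
      by (rule is_cokernel_cancel[OF c, rotated 2]) (use gh ar in \<open>auto simp: preadd_simps\<close>)
    then show "g = h" using is_pushout_cancel[OF P, of g X h] gh ar by auto
  qed (use ar in \<open>auto simp: preadd_simps\<close>)
qed

end

context additive_category
begin

lemma ex_biproduct2:
  assumes "A \<in> Obj C" "B \<in> Obj C"
  obtains S i1 i2 p1 p2 where "biproduct2 C A B S i1 i2 p1 p2"
proof -
  have "\<exists>S inc pr. is_biproduct C 2 (\<lambda>k::nat. if k = 0 then A else B) S inc pr"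
    by (rule biproducts_exist) (use assms in auto)
  then show ?thesis using that unfolding is_biproduct_2_iff by auto
qed

end

section \<open>Admissible monics: pushouts, split monics and maps into a sum\<close>

context exact_category
begin

lemma pair_simps:
  assumes "(i, p) \<in> E"
  shows "i \<in> Arr C" "p \<in> Arr C" "Dom C p = Cod C i" "is_kernel C i p" "is_cokernel C p i"
  using pairs[OF assms] by (auto simp: kernel_cokernel_pair_def is_kernel_def)

text \<open>The isomorphism of pairs is \<open>b\<close> in the middle and the identity at both
  ends.\<close>

lemma pair_iso_middle:
  assumes E: "(i, p) \<in> E" and b: "b \<in> Hom C (Cod C i) B" "b' \<in> Hom C B (Cod C i)"
    and inv: "b' \<cdot> b = Id C (Cod C i)" "b \<cdot> b' = Id C B"
  shows "(b \<cdot> i, p \<cdot> b') \<in> E"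
proof (rule iso_closed[OF E])
  show "kernel_cokernel_pair C (b \<cdot> i) (p \<cdot> b')"
    by (rule kernel_cokernel_pair_iso_middle[OF pairs[OF E] b inv])
  have iso: "is_iso C (Id C A)" if "A \<in> Obj C" for A
    by (rule is_isoI[of _ A A "Id C A"]) (use that in \<open>auto simp: cat_simps\<close>)
  have "is_iso C b" by (rule is_isoI[OF b inv])
  moreover have "p \<cdot> b' \<cdot> b = p"
    using pair_simps[OF E] b inv by (auto simp: cat_simps Comp_assoc_Arr)
  ultimately show "pair_iso C (i, p) (b \<cdot> i, p \<cdot> b')"
    unfolding pair_iso_def prod.case using pair_simps[OF E] b
    by (intro bexI[of _ "Id C (Dom C i)"] bexI[of _ b] bexI[of _ "Id C (Cod C p)"])
      (auto simp: cat_simps iso)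
qed

text \<open>The axiom provides some pushout that is an admissible monic. Any other pushout of the
  same span differs from it by an isomorphism of the codomain, which preserves
  admissibility.\<close>

lemma pushout_admissible_monic:
  assumes "admissible_monic E i" "is_pushout C i f i' f'"
  shows "admissible_monic E i'"
proof -
  have f: "f \<in> Arr C" "Dom C f = Dom C i" using assms(2) by (auto simp: is_pushout_def)
  obtain i'' f'' p where P: "is_pushout C i f i'' f''" "(i'', p) \<in> E"
    using pushout_monic[OF assms(1) f] by (auto simp: admissible_monic_def)
  obtain g h where gh: "g \<in> Hom C (Cod C i'') (Cod C i')" "h \<in> Hom C (Cod C i') (Cod C i'')"
    "h \<cdot> g = Id C (Cod C i'')" "g \<cdot> h = Id C (Cod C i')" "g \<cdot> i'' = i'"
    by (rule is_pushout_unique[OF P(1) assms(2)])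
  show ?thesis
    using pair_iso_middle[OF P(2) gh(1-4)] gh(5) by (auto simp: admissible_monic_def)
qed

text \<open>The identity of \<open>A\<close> is an admissible epic, so it has a kernel
  \<open>k\<close> in \<open>E\<close>. Since the identity composed with \<open>k\<close> is both
  \<open>k\<close> and zero, \<open>k\<close> is a zero arrow.\<close>

lemma zero_kernel_Id:
  assumes "A \<in> Obj C"
  obtains Z where "Z \<in> Obj C" "Id C Z = Zero C Z Z" "(Zero C Z A, Id C A) \<in> E"
proof -
  obtain k where k: "(k, Id C A) \<in> E"
    using Id_epic[OF assms] by (auto simp: admissible_epic_def)
  define Z where "Z = Dom C k"
  have Z: "Z \<in> Obj C" using pair_simps[OF k] by (simp add: Z_def Dom_in_Obj)
  have "Id C A \<cdot> k = Zero C Z (Cod C (Id C A))"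
    using pair_simps(4)[OF k] unfolding is_kernel_def Z_def by blast
  moreover have "Id C A \<cdot> k = k"
    by (rule Comp_Id(1)) (use pair_simps(1,3)[OF k] assms in \<open>simp_all add: Id_simps\<close>)
  ultimately have "k = Zero C Z A" using assms by (simp only: Id_simps)
  then have E: "(Zero C Z A, Id C A) \<in> E" using k by simp
  \<comment> \<open>The identity and the zero arrow of \<open>Z\<close> have the same composite with
    the kernel, and a kernel can be cancelled.\<close>
  have "Id C Z = Zero C Z Z"
    by (rule is_kernel_cancel[OF pair_simps(4)[OF E], of _ Z]) (use Z assms in \<open>auto simp: preadd_simps\<close>)
  then show ?thesis using that Z E by blast
qed

text \<open>The injection \<open>i1\<close> is a pushout of the arrow from a zero object to
  \<open>B\<close>, which is an admissible monic as the kernel of an identity.\<close>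

lemma biproduct2_admissible_monic:
  assumes b: "biproduct2 C A B S i1 i2 p1 p2"
  shows "admissible_monic E i1"
proof -
  have "B \<in> Obj C" using b by (simp add: biproduct2_def)
  then obtain Z where Z: "Z \<in> Obj C" "Id C Z = Zero C Z Z" "(Zero C Z B, Id C B) \<in> E"
    by (rule zero_kernel_Id)
  then have "admissible_monic E (Zero C Z B)" by (auto simp: admissible_monic_def)
  then show ?thesis
    by (rule pushout_admissible_monic[OF _ biproduct2_is_pushout[OF b Z(1,2)]])
qed

text \<open>
  \<open>(i, n)\<close> is the split monic \<open>(1, n)\<close>, the first injection of a twisted biproduct, followed by
  \<open>i \<oplus> 1\<close>, a pushout of \<open>i\<close>.
\<close>

lemma admissible_monic_into_sum:
  assumes i: "admissible_monic E i" and T: "biproduct2 C (Cod C i) B T j1 j2 q1 q2"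
    and n: "n \<in> Hom C (Dom C i) B"
  shows "admissible_monic E (j1 \<cdot> i \<oplus> j2 \<cdot> n)"
proof -
  have iA: "i \<in> Arr C" using i pair_simps by (auto simp: admissible_monic_def)
  have B: "B \<in> Obj C" using T by (simp add: biproduct2_def)
  obtain S i1 i2 p1 p2 where S: "biproduct2 C (Dom C i) B S i1 i2 p1 p2"
    by (rule ex_biproduct2[of "Dom C i" B]) (use iA B in \<open>auto simp: Dom_in_Obj\<close>)
  \<comment> \<open>The arrow \<open>f\<close> is the negative of \<open>n\<close>, needed to twist
    the biproduct by \<open>n\<close>.\<close>
  obtain f where f: "f \<in> Hom C (Dom C i) B" "n \<oplus> f = Zero C (Dom C i) B"
    using ex_negative[OF n] .
  have fn: "f \<oplus> n = Zero C (Dom C i) B"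
    using f n Add_commute[of n "Dom C i" B f] by (auto simp: Hom_def)
  have 1: "admissible_monic E (i1 \<oplus> i2 \<cdot> n)"
    by (rule biproduct2_admissible_monic[OF biproduct2_twist[OF S f(1) n fn]])
  let ?s = "j1 \<cdot> i \<cdot> p1 \<oplus> j2 \<cdot> p2"
  have 2: "admissible_monic E ?s"
    by (rule pushout_admissible_monic[OF i is_pushout_sum_Id[OF S T]]) (use iA in \<open>auto simp: Hom_def\<close>)
  note b = S[unfolded biproduct2_def] T[unfolded biproduct2_def] n iA
  have "admissible_monic E (?s \<cdot> (i1 \<oplus> i2 \<cdot> n))"
    by (rule Comp_monic[OF 1 2]) (use b in \<open>auto simp: preadd_simps\<close>)
  also have "?s \<cdot> (i1 \<oplus> i2 \<cdot> n) = j1 \<cdot> i \<oplus> j2 \<cdot> n"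
    using b by (auto simp: preadd_simps Comp_Add_distrib Comp_assoc_Arr biproduct2_Comp[OF S])
  finally show ?thesis .
qed

end

section \<open>The opposite exact category\<close>

definition op_cat :: "('o, 'm, 'z) add_cat_scheme \<Rightarrow> ('o, 'm) add_cat" where
  "op_cat C = \<lparr>Obj = Obj C, Arr = Arr C, Dom = Cod C, Cod = Dom C, Id = Id C,
     Comp = (\<lambda>g f. Comp C f g), Add = Add C, Zero = (\<lambda>A B. Zero C B A)\<rparr>"

lemma op_cat_simps [simp]:
  "Obj (op_cat C) = Obj C" "Arr (op_cat C) = Arr C" "Dom (op_cat C) = Cod C" "Cod (op_cat C) = Dom C"
  "Id (op_cat C) = Id C" "Comp (op_cat C) g f = Comp C f g" "Add (op_cat C) = Add C"
  "Zero (op_cat C) A B = Zero C B A"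
  by (simp_all add: op_cat_def)

lemma Hom_op_cat [simp]: "Hom (op_cat C) A B = Hom C B A"
  by (auto simp: Hom_def)

lemma Hom_group_op_cat [simp]: "Hom_group (op_cat C) A B = Hom_group C B A"
  by (simp add: Hom_group_def)

lemma is_iso_op_cat [simp]: "is_iso (op_cat C) f \<longleftrightarrow> is_iso C f"
  by (auto simp: is_iso_def)

lemma isomorphic_op_cat [simp]: "isomorphic (op_cat C) A B \<longleftrightarrow> isomorphic C B A"
  by (auto simp: isomorphic_def)

lemma is_kernel_op_cat [simp]: "is_kernel (op_cat C) i p \<longleftrightarrow> is_cokernel C i p"
  unfolding is_kernel_def is_cokernel_def by auto

lemma is_cokernel_op_cat [simp]: "is_cokernel (op_cat C) p i \<longleftrightarrow> is_kernel C p i"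
  unfolding is_kernel_def is_cokernel_def by auto

lemma kernel_cokernel_pair_op_cat [simp]:
  "kernel_cokernel_pair (op_cat C) p i \<longleftrightarrow> kernel_cokernel_pair C i p"
  unfolding kernel_cokernel_pair_def by auto

lemma is_pushout_op_cat [simp]: "is_pushout (op_cat C) p f p' f' \<longleftrightarrow> is_pullback C p f p' f'"
  unfolding is_pushout_def is_pullback_def by auto

lemma is_pullback_op_cat [simp]: "is_pullback (op_cat C) p f p' f' \<longleftrightarrow> is_pushout C p f p' f'"
  unfolding is_pushout_def is_pullback_def by auto

lemma is_biproduct_op_cat [simp]:
  "is_biproduct (op_cat C) n A B inc pr \<longleftrightarrow> is_biproduct C n A B pr inc"
  unfolding is_biproduct_def by auto

lemma admissible_converse [simp]:
  "admissible_monic (E\<inverse>) p \<longleftrightarrow> admissible_epic E p"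
  "admissible_epic (E\<inverse>) i \<longleftrightarrow> admissible_monic E i"
  by (auto simp: admissible_monic_def admissible_epic_def)

text \<open>Insert \<open>a \<cdot> a'\<close> after \<open>i'\<close> in the composite, move
  \<open>a\<close> across the given square and cancel \<open>b' \<cdot> b\<close>.\<close>

lemma (in category) inverse_square:
  assumes "i \<in> Hom C A B" "i' \<in> Hom C A' B'" "a \<in> Hom C A A'" "b \<in> Hom C B B'"
    "a' \<in> Hom C A' A" "b' \<in> Hom C B' B"
    "a \<cdot> a' = Id C A'" "b' \<cdot> b = Id C B" "b \<cdot> i = i' \<cdot> a"
  shows "b' \<cdot> i' = i \<cdot> a'"
proof -
  have "b' \<cdot> i' = b' \<cdot> (i' \<cdot> a \<cdot> a')"
    using assms by (simp add: cat_simps Comp_assoc_Arr)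
  also have "\<dots> = b' \<cdot> (b \<cdot> i \<cdot> a')"
    by (simp add: assms(9))
  also have "\<dots> = i \<cdot> a'"
    using assms(1-6) by (simp add: cat_simps Comp_assoc_Arr Comp_assoc_eq[OF assms(8)])
  finally show ?thesis .
qed

text \<open>Passing to the opposite category reverses the direction of the three isomorphisms.
  Symmetry turns them back, as closure of \<open>E^-1\<close> under isomorphism requires.\<close>

lemma (in category) pair_iso_sym:
  assumes "pair_iso C (i, p) (i', p')" "i \<in> Arr C" "p \<in> Arr C" "Dom C p = Cod C i"
    "i' \<in> Arr C" "p' \<in> Arr C" "Dom C p' = Cod C i'"
  shows "pair_iso C (i', p') (i, p)"
proof -
  obtain a b c where abc: "a \<in> Hom C (Dom C i) (Dom C i')" "b \<in> Hom C (Cod C i) (Cod C i')"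
    "c \<in> Hom C (Cod C p) (Cod C p')" "is_iso C a" "is_iso C b" "is_iso C c"
    "b \<cdot> i = i' \<cdot> a" "c \<cdot> p = p' \<cdot> b"
    using assms(1) unfolding pair_iso_def by blast
  obtain a' where a': "a' \<in> Hom C (Dom C i') (Dom C i)" "a' \<cdot> a = Id C (Dom C i)" "a \<cdot> a' = Id C (Dom C i')"
    using is_isoE[OF abc(4)] abc(1) by (auto simp: Hom_def)
  obtain b' where b': "b' \<in> Hom C (Cod C i') (Cod C i)" "b' \<cdot> b = Id C (Cod C i)" "b \<cdot> b' = Id C (Cod C i')"
    using is_isoE[OF abc(5)] abc(2) by (auto simp: Hom_def)
  obtain c' where c': "c' \<in> Hom C (Cod C p') (Cod C p)" "c' \<cdot> c = Id C (Cod C p)" "c \<cdot> c' = Id C (Cod C p')"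
    using is_isoE[OF abc(6)] abc(3) by (auto simp: Hom_def)
  have H: "i \<in> Hom C (Dom C i) (Cod C i)" "i' \<in> Hom C (Dom C i') (Cod C i')"
    "p \<in> Hom C (Cod C i) (Cod C p)" "p' \<in> Hom C (Cod C i') (Cod C p')"
    using assms by (auto simp: Hom_def)
  have "b' \<cdot> i' = i \<cdot> a'" "c' \<cdot> p' = p \<cdot> b'"
    using inverse_square[OF H(1,2) abc(1,2) a'(1) b'(1) a'(3) b'(2) abc(7)]
      inverse_square[OF H(3,4) abc(2,3) b'(1) c'(1) b'(3) c'(2) abc(8)] by auto
  moreover have "is_iso C a'" "is_iso C b'" "is_iso C c'"
    using is_isoI[OF a'(1) abc(1) a'(3,2)] is_isoI[OF b'(1) abc(2) b'(3,2)]
      is_isoI[OF c'(1) abc(3) c'(3,2)] by auto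
  ultimately show ?thesis unfolding pair_iso_def using a'(1) b'(1) c'(1) by blast
qed

text \<open>The axioms are self-dual or come in dual pairs. Closure under isomorphism takes separate
  care, because the isomorphisms change direction.\<close>

lemma (in exact_category) exact_category_op_cat: "exact_category (op_cat C) (E\<inverse>)"
proof (intro exact_category.intro additive_category.intro preadditive_category.intro category.intro
    exact_category_axioms.intro additive_category_axioms.intro preadditive_category_axioms.intro)
  fix p i p' i'
  assume "(p, i) \<in> E\<inverse>" "kernel_cokernel_pair (op_cat C) p' i'" "pair_iso (op_cat C) (p, i) (p', i')"
  then have E: "(i, p) \<in> E" and kc: "kernel_cokernel_pair C i' p'"
    and iso: "pair_iso (op_cat C) (p, i) (p', i')" by auto
  have ar: "i' \<in> Arr C" "p' \<in> Arr C" "Dom C p' = Cod C i'"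
    using kc by (auto simp: kernel_cokernel_pair_def is_kernel_def)
  obtain a b c where "a \<in> Hom C (Cod C p') (Cod C p)" "b \<in> Hom C (Cod C i') (Cod C i)"
    "c \<in> Hom C (Dom C i') (Dom C i)" "is_iso C a" "is_iso C b" "is_iso C c"
    "p \<cdot> b = a \<cdot> p'" "i \<cdot> c = b \<cdot> i'"
    using iso ar pair_simps[OF E] unfolding pair_iso_def by auto
  \<comment> \<open>The two outer isomorphisms \<open>a\<close> and \<open>c\<close> exchange
    places.\<close>
  then have "pair_iso C (i', p') (i, p)"
    unfolding pair_iso_def prod.case by metis
  then have "pair_iso C (i, p) (i', p')"
    using pair_iso_sym ar pair_simps[OF E] by blast
  then show "(p', i') \<in> E\<inverse>" using iso_closed[OF E kc] by simp
next
  fix n :: nat and A assume "\<And>k. k < n \<Longrightarrow> A k \<in> Obj (op_cat C)"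
  then show "\<exists>B inc pr. is_biproduct (op_cat C) n A B inc pr"
    using biproducts_exist[of n A] by auto
qed (use Comp_assoc pairs pushout_monic pullback_epic in
    \<open>auto simp: Cod_in_Obj Dom_in_Obj Id_in_Hom Comp_in_Hom Comp_Id_left Comp_Id_right
      Hom_comm_group Comp_Add_right Comp_Add_left Id_monic Id_epic Comp_monic Comp_epic\<close>)

section \<open>Sub-additive functions and the exact axioms for admissible monics\<close>

locale subadditive_function = exact_category C E
  for C :: "('o, 'm, 'z) add_cat_scheme" and E :: "('m \<times> 'm) set" +
  fixes \<phi> :: "'o \<Rightarrow> int"
  assumes phi_iso: "A \<in> Obj C \<Longrightarrow> B \<in> Obj C \<Longrightarrow> isomorphic C A B \<Longrightarrow> \<phi> A = \<phi> B"
    and phi_biproduct: "is_biproduct C n F S inc pr \<Longrightarrow> \<phi> S = (\<Sum>k<n. \<phi> (F k))"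
    and phi_subadditive: "(i, p) \<in> E \<Longrightarrow> \<phi> (Cod C i) \<le> \<phi> (Dom C i) + \<phi> (Cod C p)"
begin

lemma phi_biproduct2:
  assumes "biproduct2 C A B S i1 i2 p1 p2"
  shows "\<phi> S = \<phi> A + \<phi> B"
proof -
  have "is_biproduct C 2 (\<lambda>k. if k = 0 then A else B) S
      (\<lambda>k. if k = 0 then i1 else i2) (\<lambda>k. if k = 0 then p1 else p2)"
    unfolding is_biproduct_2_iff using assms by simp
  from phi_biproduct[OF this] show ?thesis by (simp add: numeral_2_eq_2)
qed

text \<open>A zero object is the biproduct of the empty family, on which the sum is empty.\<close>

lemma phi_zero:
  assumes "Z \<in> Obj C" "Id C Z = Zero C Z Z"
  shows "\<phi> Z = 0"
  using phi_biproduct[of 0] assms by (simp add: is_biproduct_0_iff)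

lemma phi_cokernels:
  assumes "is_cokernel C p i" "is_cokernel C q i"
  shows "\<phi> (Cod C p) = \<phi> (Cod C q)"
  using phi_iso[OF _ _ is_cokernel_isomorphic[OF assms]] assms
  by (auto simp: is_cokernel_def Cod_in_Obj)

lemma phi_pushout_le:
  assumes i: "admissible_monic E i" and P: "is_pushout C i f i' f'"
  shows "\<phi> (Cod C i) + \<phi> (Cod C f) \<le> \<phi> (Dom C i) + \<phi> (Cod C i')"
proof -
  have ar: "i \<in> Arr C" "f \<in> Arr C" "Dom C i = Dom C f" "i' \<in> Arr C" "f' \<in> Arr C"
    "Dom C i' = Cod C f" "Dom C f' = Cod C i" "Cod C i' = Cod C f'"
    using P by (auto simp: is_pushout_def)
  obtain T j1 j2 q1 q2 where T: "biproduct2 C (Cod C i) (Cod C f) T j1 j2 q1 q2"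
    by (rule ex_biproduct2[of "Cod C i" "Cod C f"]) (use ar in \<open>auto simp: Cod_in_Obj\<close>)
  obtain n where n: "n \<in> Hom C (Dom C f) (Cod C f)" "f \<oplus> n = Zero C (Dom C f) (Cod C f)"
    by (rule ex_negative[of f "Dom C f" "Cod C f"]) (use ar in \<open>auto simp: Hom_def\<close>)
  let ?m = "j1 \<cdot> i \<oplus> j2 \<cdot> n" and ?q = "f' \<cdot> q1 \<oplus> i' \<cdot> q2"
  have cok: "is_cokernel C ?q ?m" by (rule pushout_is_cokernel_sum[OF P T n])
  \<comment> \<open>The epic \<open>q\<close> paired with \<open>?m\<close> in \<open>E\<close> is
    not explicit, but \<open>?q\<close> is also a cokernel of \<open>?m\<close>, so
    \<open>\<phi>\<close> takes the same value on both codomains.\<close>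
  obtain q where q: "(?m, q) \<in> E"
    using admissible_monic_into_sum[OF i T] n ar by (auto simp: admissible_monic_def)
  have "\<phi> (Cod C q) = \<phi> (Cod C ?q)" by (rule phi_cokernels[OF pair_simps(5)[OF q] cok])
  moreover have "Cod C ?q = Cod C i'" "Dom C ?m = Dom C i" "Cod C ?m = T"
    using ar n(1) T[unfolded biproduct2_def] by (auto simp: preadd_simps)
  ultimately show ?thesis using phi_subadditive[OF q] phi_biproduct2[OF T] by simp
qed

text \<open>The pair from a zero object to \<open>A\<close> to \<open>A\<close> is additive because
  \<open>\<phi>\<close> vanishes on zero objects. The axiom for identities as monics is obtained
  from this one by duality.\<close>

lemma Id_epic_additive:
  assumes "A \<in> Obj C"
  shows "admissible_epic (additive_pairs C E \<phi>) (Id C A)"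
proof -
  obtain Z where Z: "Z \<in> Obj C" "Id C Z = Zero C Z Z" "(Zero C Z A, Id C A) \<in> E"
    using zero_kernel_Id[OF assms] .
  have "(Zero C Z A, Id C A) \<in> additive_pairs C E \<phi>"
    using Z phi_zero[OF Z(1,2)] assms by (simp add: additive_pairs_def cat_simps Zero_simps)
  then show ?thesis by (auto simp: admissible_epic_def)
qed

lemma pushout_monic_additive:
  assumes i: "admissible_monic (additive_pairs C E \<phi>) i" and f: "f \<in> Arr C" "Dom C f = Dom C i"
  shows "\<exists>i' f'. is_pushout C i f i' f' \<and> admissible_monic (additive_pairs C E \<phi>) i'"
proof -
  obtain p where p: "(i, p) \<in> E" "\<phi> (Cod C i) = \<phi> (Dom C i) + \<phi> (Cod C p)"
    using i by (auto simp: admissible_monic_def additive_pairs_def)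
  then have iE: "admissible_monic E i" by (auto simp: admissible_monic_def)
  obtain i' f' p' where P: "is_pushout C i f i' f'" and p': "(i', p') \<in> E"
    using pushout_monic[OF iE f] by (auto simp: admissible_monic_def)
  obtain r where "is_cokernel C r i'" "Cod C r = Cod C p"
    using pushout_cokernel[OF P pair_simps(5)[OF p(1)]] .
  then have "\<phi> (Cod C p') = \<phi> (Cod C p)"
    using phi_cokernels[OF pair_simps(5)[OF p'], of r] by simp
  moreover have "Dom C i' = Cod C f" using P by (auto simp: is_pushout_def)
  \<comment> \<open>One inequality is sub-additivity on the new pair. The other is the pushout
    inequality, after \<open>\<phi> (Cod C i)\<close> is expanded by additivity on the given
    pair.\<close>
  ultimately have "\<phi> (Cod C i') = \<phi> (Dom C i') + \<phi> (Cod C p')"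
    using phi_pushout_le[OF iE P] phi_subadditive[OF p'] p(2) by simp
  then have "(i', p') \<in> additive_pairs C E \<phi>" using p' by (simp add: additive_pairs_def)
  then show ?thesis using P by (auto simp: admissible_monic_def)
qed

text \<open>Noether: the pushout of \<open>j\<close> along the cokernel of \<open>i\<close> is the cokernel of \<open>j \<cdot> i\<close>, which is therefore
  an extension of the cokernel of \<open>j\<close> by that of \<open>i\<close>.\<close>

lemma Comp_monic_additive:
  assumes i: "admissible_monic (additive_pairs C E \<phi>) i" and j: "admissible_monic (additive_pairs C E \<phi>) j"
    and ij: "Cod C i = Dom C j"
  shows "admissible_monic (additive_pairs C E \<phi>) (j \<cdot> i)"
proof -
  obtain p where p: "(i, p) \<in> E" "\<phi> (Cod C i) = \<phi> (Dom C i) + \<phi> (Cod C p)"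
    using i by (auto simp: admissible_monic_def additive_pairs_def)
  obtain q where q: "(j, q) \<in> E" "\<phi> (Cod C j) = \<phi> (Dom C j) + \<phi> (Cod C q)"
    using j by (auto simp: admissible_monic_def additive_pairs_def)
  note ps = pair_simps[OF p(1)] and qs = pair_simps[OF q(1)]
  have iE: "admissible_monic E i" and jE: "admissible_monic E j"
    using p q by (auto simp: admissible_monic_def)
  obtain r where r: "(j \<cdot> i, r) \<in> E"
    using Comp_monic[OF iE jE ij] by (auto simp: admissible_monic_def)
  obtain j' p' s where P: "is_pushout C j p j' p'" and s: "(j', s) \<in> E"
    using pushout_monic[OF jE ps(2)] ps(3) ij by (auto simp: admissible_monic_def)
  have js: "Dom C j' = Cod C p" "Cod C j' = Cod C p'" using P by (auto simp: is_pushout_def)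
  have 1: "\<phi> (Cod C r) = \<phi> (Cod C p')"
    by (rule phi_cokernels[OF pair_simps(5)[OF r] pushout_along_cokernel[OF ps(5) P]])
  obtain t where "is_cokernel C t j'" "Cod C t = Cod C q"
    using pushout_cokernel[OF P qs(5)] .
  then have 2: "\<phi> (Cod C s) = \<phi> (Cod C q)"
    using phi_cokernels[OF pair_simps(5)[OF s], of t] by simp
  have 3: "Dom C (j \<cdot> i) = Dom C i" "Cod C (j \<cdot> i) = Cod C j"
    using ps qs ij by (auto simp: cat_simps)
  \<comment> \<open>Chaining sub-additivity on the composite with that on its cokernel bounds
    \<open>\<phi> (Cod C j)\<close> by the values at \<open>Dom C i\<close>, \<open>Cod C p\<close>
    and \<open>Cod C q\<close>. Additivity on the two given pairs makes this bound an equality, so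
    both inequalities are equalities.\<close>
  have "\<phi> (Cod C (j \<cdot> i)) = \<phi> (Dom C (j \<cdot> i)) + \<phi> (Cod C r)"
    using phi_subadditive[OF r] phi_subadditive[OF s] p(2) q(2) 1 2 3 js ij by simp
  then show ?thesis using r by (auto simp: admissible_monic_def additive_pairs_def)
qed

section \<open>Duality for \<open>\<phi>\<close> and the exact structure of additive pairs\<close>

lemma subadditive_function_op_cat: "subadditive_function (op_cat C) (E\<inverse>) \<phi>"
proof -
  interpret op: exact_category "op_cat C" "E\<inverse>" by (rule exact_category_op_cat)
  show ?thesis
  proof unfold_locales
    show "\<phi> A = \<phi> B" if "A \<in> Obj (op_cat C)" "B \<in> Obj (op_cat C)" "isomorphic (op_cat C) A B" for A B
      using phi_iso[of B A] that by simp
    show "\<phi> B = (\<Sum>k<n. \<phi> (A k))" if "is_biproduct (op_cat C) n A B inc pr" for n A B inc pr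
      using phi_biproduct[of n A B pr inc] that by simp
    show "\<phi> (Cod (op_cat C) p) \<le> \<phi> (Dom (op_cat C) p) + \<phi> (Cod (op_cat C) i)" if "(p, i) \<in> E\<inverse>" for p i
      using phi_subadditive[of i p] pair_simps[of i p] that by simp
  qed
qed

text \<open>Additivity is symmetric in the two ends, and the middle object is both
  \<open>Cod C i\<close> and \<open>Dom C p\<close>.\<close>

lemma additive_pairs_op_cat: "additive_pairs (op_cat C) (E\<inverse>) \<phi> = (additive_pairs C E \<phi>)\<inverse>"
  using pair_simps(3) by (auto simp: additive_pairs_def)

lemma additive_pairs_iso_closed:
  assumes E: "(i, p) \<in> additive_pairs C E \<phi>" and kc: "kernel_cokernel_pair C i' p'"
    and iso: "pair_iso C (i, p) (i', p')"
  shows "(i', p') \<in> additive_pairs C E \<phi>"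
proof -
  have "(i, p) \<in> E" using E by (simp add: additive_pairs_def)
  then have "(i', p') \<in> E" using iso_closed kc iso by blast
  note ps = pair_simps[OF \<open>(i, p) \<in> E\<close>] pair_simps[OF \<open>(i', p') \<in> E\<close>]
  have "isomorphic C (Dom C i) (Dom C i')" "isomorphic C (Cod C i) (Cod C i')"
    "isomorphic C (Cod C p) (Cod C p')"
    using iso by (auto simp: pair_iso_def isomorphic_def)
  then have "\<phi> (Dom C i) = \<phi> (Dom C i')" "\<phi> (Cod C i) = \<phi> (Cod C i')" "\<phi> (Cod C p) = \<phi> (Cod C p')"
    using phi_iso ps by (simp_all add: cat_simps)
  then show ?thesis using E \<open>(i', p') \<in> E\<close> by (simp add: additive_pairs_def)
qed

text \<open>Identities as epics, composites of monics and pushouts of monics are handled directly.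
  Identities as monics, composites of epics and pullbacks of epics are the same statements in the
  opposite category.\<close>

lemma exact_category_additive_pairs: "exact_category C (additive_pairs C E \<phi>)"
proof -
  interpret op: subadditive_function "op_cat C" "E\<inverse>" \<phi> by (rule subadditive_function_op_cat)
  note dual = op.Id_epic_additive op.Comp_monic_additive op.pushout_monic_additive
  show ?thesis
  proof unfold_locales
    show "kernel_cokernel_pair C i p" if "(i, p) \<in> additive_pairs C E \<phi>" for i p
      using that pairs by (simp add: additive_pairs_def)
  qed (use Id_epic_additive Comp_monic_additive pushout_monic_additive dual in
      \<open>simp_all add: additive_pairs_op_cat additive_pairs_iso_closed\<close>)
qed

end

theorem theorem4p8:
  fixes C :: "('o, 'm) add_cat"
    and E :: "('m \<times> 'm) set"
    and \<phi> :: "'o \<Rightarrow> int"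
  assumes exact: "exact_category C E"
    and iso_invariant: "\<And>A B. A \<in> Obj C \<Longrightarrow> B \<in> Obj C \<Longrightarrow> isomorphic C A B \<Longrightarrow> \<phi> A = \<phi> B"
    and additive_on_biproducts: "\<And>n A B inc pr. is_biproduct C n A B inc pr \<Longrightarrow> \<phi> B = (\<Sum>k<n. \<phi> (A k))"
    and subadditive: "\<And>i p. (i, p) \<in> E \<Longrightarrow> \<phi> (Cod C i) \<le> \<phi> (Dom C i) + \<phi> (Cod C p)"
  shows "exact_subcategory C (additive_pairs C E \<phi>) C E"
proof -
  interpret exact_category C E by (rule exact)
  interpret subadditive_function C E \<phi>
    by unfold_locales (fact iso_invariant additive_on_biproducts subadditive)+
  \<comment> \<open>Only the class of pairs shrinks. The category is unchanged, so fullness and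
    closure under isomorphism are immediate.\<close>
  have "full_subcategory C C"
    by (auto simp: full_subcategory_def Dom_in_Obj Cod_in_Obj)
  moreover have "additive_pairs C E \<phi> \<subseteq> E" by (auto simp: additive_pairs_def)
  ultimately show ?thesis
    using exact exact_category_additive_pairs by (auto simp: exact_subcategory_def)
qed

end
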